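(* Let $\mu$ be a probability measure on $\mathbb{R}$ with a positive density $f$ on $\mathbb{R}$, cumulative distribution function $F$ and median $m\in\mathbb{R}$. Let $g\in L_\infty(F)$ and $h\in L_1(F)$ be absolutely continuous. Then $$ |\operatorname{Cov}(g,h)|\le Is(\mu)^{-1}\max\left\{\sup_{a<x\le m}\left|\frac{\int_a^x h\,dF}{F(x)}-\mathbb{E}[h]\right|,\ \sup_{m<x<b}\left|\frac{\int_x^b h\,dF}{1-F(x)}-\mathbb{E}[h]\right|\right\}\int_{\mathbb{R}}|g'|\,dF, $$ where $a=\inf\{x:F(x)>0\}$ and $b=\sup\{x:F(x)<1\}$.
   Context: $L_p(F)$ is the $L_p$ space of $\mu$; expectations and covariances are taken with respect to $\mu$: $\mathbb{E}[h]=\int h\,d\mu$ and $\operatorname{Cov}(g,h)=\int g\,(h-\mathbb{E}[h])\,d\mu$. Absolutely continuous functions on $\mathbb{R}$ are understood to be absolutely continuous on every compact interval; $g'$ denotes the a.e. derivative. $Is(\mu)$ is the Cheeger isoperimetric constant of $\mu$: the largest $c\ge 0$ such that $\mu^+(A)\ge c\min\{\mu(A),1-\mu(A)\}$ for all measurable $A\subset\mathbb{R}$, where $\mu^+(A)=\liminf_{h\to0^+}(\mu(A^h)-\mu(A))/h$ and $A^h=\{x:\exists a\in A,\ |x-a|<h\}$. On $\mathbb{R}$ it is given by $$Is(\mu)=\operatorname*{ess\,inf}_{a<x<b}\frac{f(x)}{\min\{F(x),1-F(x)\}}$$ (essential infimum with respect to Lebesgue measure). If $Is(\mu)=0$, then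 $Is(\mu)^{-1}=+\infty$ and the inequality is uninformative. *)

theory Defs
  imports "HOL-Probability.Probability"
begin

definition absolutely_continuous_on_interval :: "real \<Rightarrow> real \<Rightarrow> (real \<Rightarrow> real) \<Rightarrow> bool" where
  "absolutely_continuous_on_interval c d g \<longleftrightarrow>
    (\<forall>\<epsilon>>0. \<exists>\<delta>>0. \<forall>(n::nat) u v.
       (\<forall>i<n. c \<le> u i \<and> u i \<le> v i \<and> v i \<le> d) \<and>
       disjoint_family_on (\<lambda>i. {u i<..<v i}) {..<n} \<and>
       (\<Sum>i<n. v i - u i) < \<delta> \<longrightarrow>
       (\<Sum>i<n. \<bar>g (v i) - g (u i)\<bar>) < \<epsilon>)"

definition locally_absolutely_continuous :: "(real \<Rightarrow> real) \<Rightarrow> bool" where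
  "locally_absolutely_continuous g \<longleftrightarrow> (\<forall>c d. absolutely_continuous_on_interval c d g)"

definition enlargement :: "real \<Rightarrow> real set \<Rightarrow> real set" where
  "enlargement r A = {x. \<exists>a\<in>A. \<bar>x - a\<bar> < r}"

definition boundary_measure :: "real measure \<Rightarrow> real set \<Rightarrow> ennreal" where
  "boundary_measure M A =
    Liminf (at_right 0) (\<lambda>r. (emeasure M (enlargement r A) - emeasure M A) / ennreal r)"

text \<open>The largest admissible constant is written as a supremum in the extended nonnegative reals, so
  that \<open>inverse (isoperimetric_const M)\<close> is infinite when the constant vanishes.\<close>

definition isoperimetric_const :: "real measure \<Rightarrow> ennreal" where
  "isoperimetric_const M =
    Sup {c. \<forall>A\<in>sets M. c * min (emeasure M A) (1 - emeasure M A) \<le> boundary_measure M A}"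

definition lower_endpoint :: "real measure \<Rightarrow> ereal" where
  "lower_endpoint M = Inf {ereal x | x. 0 < cdf M x}"

definition upper_endpoint :: "real measure \<Rightarrow> ereal" where
  "upper_endpoint M = Sup {ereal x | x. cdf M x < 1}"

definition is_median :: "real measure \<Rightarrow> real \<Rightarrow> bool" where
  "is_median M m \<longleftrightarrow> 1 / 2 \<le> measure M {..m} \<and> 1 / 2 \<le> measure M {m..}"

definition covariance :: "real measure \<Rightarrow> (real \<Rightarrow> real) \<Rightarrow> (real \<Rightarrow> real) \<Rightarrow> real" where
  "covariance M g h = (LINT x|M. g x * (h x - (LINT y|M. h y)))"

end

theory Submission
  imports Defs
begin

text \<open>
  Write \<open>H = h - E[h]\<close> and \<open>\<Psi> t = \<integral>{t..} H dF\<close>. An absolutely continuous \<open>g\<close> is the integral of its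
  derivative, so Fubini's theorem applied to \<open>g\<close> truncated to \<open>[-n, n]\<close> gives the covariance as the
  limit of the integrals of \<open>g' \<Psi>\<close> over \<open>[-n, n]\<close>. Since \<open>H\<close> has mean zero, \<open>\<bar>\<Psi>\<bar>\<close> is at most the maximum of
  the two suprema times \<open>min F (1 - F)\<close>: the left supremum bounds it up to the median, the right one
  beyond. Testing the isoperimetric inequality on the half-lines \<open>{..x}\<close> bounds \<open>min F (1 - F)\<close> almost
  everywhere by \<open>f\<close> divided by the isoperimetric constant.

  The derivative facts rest on the Lebesgue differentiation theorem, obtained from Vitali's covering
  theorem, and on the Radon-Nikodym theorem applied to the measures generated by the two monotone
  parts of an absolutely continuous function.
\<close>

section \<open>Lebesgue differentiation on the real line\<close>

text \<open>Lebesgue differentiation enters twice: applied to \<open>f\<close> it turns the boundary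
  measure of a half-line into the density, and applied to the density that represents
  \<open>g\<close> it identifies that density almost everywhere with \<open>deriv g\<close>, the
  function in the statement. Truncation is forced because a bounded absolutely continuous
  \<open>g\<close> (the sine, say) need not have a derivative that is Lebesgue integrable over the
  line, so Fubini's theorem has no product bound there; on \<open>[-n, n]\<close> it has one, and
  the boundedness of \<open>g\<close> then dominates the passage to the limit. The median is the
  point where the minimum of \<open>F\<close> and \<open>1 - F\<close> switches from one to the
  other, hence where the two suprema meet. The estimates live in \<open>ennreal\<close> because the
  inverse constant, the suprema and the integral of \<open>\<bar>deriv g\<bar>\<close> may all be
  infinite; since zero times infinity is zero there, the final product is reached by chaining
  pointwise bounds rather than by dividing.\<close>

lemma emeasure_Union_countable_le:
  assumes "countable D" "D \<subseteq> sets M"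
    and le: "\<And>F. finite F \<Longrightarrow> F \<subseteq> D \<Longrightarrow> emeasure M (\<Union>F) \<le> e"
  shows "emeasure M (\<Union>D) \<le> e"
proof (cases "D = {}")
  case True
  then show ?thesis by simp
next
  case False
  let ?A = "\<lambda>n::nat. \<Union>(from_nat_into D ` {..n})"
  have mem: "from_nat_into D i \<in> D" for i
    using False by (rule from_nat_into)
  have "(\<Union>n. ?A n) = \<Union>(range (from_nat_into D))"
    by auto
  also have "\<dots> = \<Union>D"
    using False assms(1) by simp
  finally have eq: "(\<Union>n. ?A n) = \<Union>D" .
  have "(SUP n. emeasure M (?A n)) = emeasure M (\<Union>n. ?A n)"
  proof (rule SUP_emeasure_incseq)
    show "range ?A \<subseteq> sets M"
      using mem assms(2) by (auto intro!: sets.finite_UN)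
    show "incseq ?A"
      by (force simp: incseq_def)
  qed
  moreover have "(SUP n. emeasure M (?A n)) \<le> e"
    by (intro SUP_least le) (use mem in auto)
  ultimately show ?thesis
    by (simp add: eq)
qed

text \<open>The measure with density \<open>\<psi>\<close> vanishes on the zeros of \<open>\<psi>\<close>, so they have an open neighbourhood of
  small \<open>\<psi>\<close>-measure; the Vitali balls inside it are short in total. Applied to \<open>\<psi> = max 0 (\<phi> - p)\<close>
  with rational \<open>p > \<phi> x\<close>, this bounds the upper derivates of the indefinite integral of \<open>\<phi>\<close>.\<close>

lemma negligible_positive_upper_density_at_zeros:
  fixes \<psi> :: "real \<Rightarrow> real"
  assumes int: "integrable lborel \<psi>" and nonneg: "\<And>x. 0 \<le> \<psi> x" and "0 < \<eta>"
  shows "negligible {x. \<psi> x = 0 \<and>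
    (\<forall>R>0. \<exists>r. 0 < r \<and> r < R \<and> \<eta> * (2 * r) < (LINT t:cball x r|lborel. \<psi> t))}"
    (is "negligible ?S")
  unfolding negligible_outer_le
proof (intro allI impI)
  fix \<epsilon> :: real
  assume "0 < \<epsilon>"
  have [measurable]: "\<psi> \<in> borel_measurable borel"
    using int by auto
  define \<nu> where "\<nu> = density lborel (\<lambda>x. ennreal (\<psi> x))"
  have sets\<nu>[measurable_cong, simp]: "sets \<nu> = sets borel"
    by (simp add: \<nu>_def)
  have \<nu>_eq: "emeasure \<nu> B = ennreal (LINT t:B|lborel. \<psi> t)" if "B \<in> sets borel" for B
  proof -
    have "emeasure \<nu> B = (\<integral>\<^sup>+t. ennreal (indicator B t * \<psi> t) \<partial>lborel)"
      unfolding \<nu>_def using that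
      by (simp add: emeasure_density indicator_def ennreal_mult if_distrib cong: if_cong)
        (intro nn_integral_cong, auto)
    also have "\<dots> = ennreal (\<integral>t. indicator B t * \<psi> t \<partial>lborel)"
      using that int nonneg
      by (intro nn_integral_eq_integral AE_I2 integrable_real_mult_indicator)
        (auto simp: mult.commute intro: integrable_mult_indicator[of B lborel \<psi>, simplified])
    finally show ?thesis
      by (simp add: set_lebesgue_integral_def)
  qed
  have fin: "emeasure \<nu> (space \<nu>) \<noteq> \<infinity>"
    using \<nu>_eq[of UNIV] by (simp add: \<nu>_def)
  define A where "A = {x. \<psi> x = 0}"
  have [measurable]: "A \<in> sets borel"
    unfolding A_def by measurable
  have "emeasure \<nu> A = 0"
  proof -
    have "(LINT t:A|lborel. \<psi> t) = (LINT t|(lborel :: real measure). (0::real))"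
      unfolding set_lebesgue_integral_def
      by (intro Bochner_Integration.integral_cong) (auto simp: A_def indicator_def)
    then show ?thesis
      using \<nu>_eq[of A] by simp
  qed
  moreover have "emeasure \<nu> A = (INF U \<in> {U. A \<subseteq> U \<and> open U}. emeasure \<nu> U)"
    by (rule outer_regular) (use fin in auto)
  \<comment> \<open>The factor \<open>\<eta>\<close> is cancelled at the end, which leaves total
    length at most \<open>\<epsilon>\<close>.\<close>
  ultimately have "(INF U \<in> {U. A \<subseteq> U \<and> open U}. emeasure \<nu> U) < ennreal (\<eta> * \<epsilon>)"
    using \<open>0 < \<epsilon>\<close> \<open>0 < \<eta>\<close> by simp
  then obtain U where U: "A \<subseteq> U" "open U" and \<nu>U: "emeasure \<nu> U < ennreal (\<eta> * \<epsilon>)"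
    by (auto simp: INF_less_iff)
  define S where "S = ?S"
  \<comment> \<open>The Vitali family, as pairs of centre and radius. For disjoint members,
    \<open>\<eta>\<close> times the total length is at most the \<open>\<nu>\<close>-measure of
    their union, hence at most that of \<open>U\<close>.\<close>
  define K where "K = {(x, r). x \<in> S \<and> 0 < r \<and> cball x r \<subseteq> U \<and>
      \<eta> * (2 * r) < (LINT t:cball x r|lborel. \<psi> t)}"
  have fine: "\<exists>i. i \<in> K \<and> x \<in> cball (fst i) (snd i) \<and> snd i < d"
    if x: "x \<in> S" and "0 < d" for x d
  proof -
    have "x \<in> U"
      using x U(1) unfolding A_def S_def by blast
    then obtain k where "0 < k" "cball x k \<subseteq> U"
      using U(2) open_contains_cball by blast
    obtain r where "0 < r" "r < min k d" "\<eta> * (2 * r) < (LINT t:cball x r|lborel. \<psi> t)"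
      using conjunct2[OF x[unfolded S_def mem_Collect_eq], rule_format, of "min k d"] \<open>0 < d\<close> \<open>0 < k\<close>
      by auto
    moreover have "cball x r \<subseteq> U"
      using \<open>cball x k \<subseteq> U\<close> \<open>r < min k d\<close> by (meson less_imp_le min_less_iff_conj order_trans subset_cball)
    ultimately show ?thesis
      using x by (intro exI[of _ "(x, r)"]) (simp add: K_def)
  qed
  have pos: "0 < snd i" if "i \<in> K" for i
    using that by (auto simp: K_def)
  obtain C where C: "countable C" "C \<subseteq> K"
    and dis: "pairwise (\<lambda>i j. disjnt (cball (fst i) (snd i)) (cball (fst j) (snd j))) C"
    and neg: "negligible (S - (\<Union>i\<in>C. cball (fst i) (snd i)))"
    by (rule Vitali_covering_theorem_cballs[OF pos fine])
  let ?B = "\<lambda>i::real \<times> real. cball (fst i) (snd i)"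
  have "emeasure lborel (\<Union>(?B ` C)) \<le> ennreal \<epsilon>"
  proof (rule emeasure_Union_countable_le)
    fix F assume F: "finite F" "F \<subseteq> ?B ` C"
    then obtain G where G: "finite G" "G \<subseteq> C" "F = ?B ` G"
      using finite_subset_image[OF F] by blast
    have "disjoint_family_on ?B G"
      using dis G(2) unfolding disjoint_family_on_def pairwise_def disjnt_def by blast
    then have "ennreal \<eta> * emeasure lborel (\<Union>F) = ennreal \<eta> * (\<Sum>i\<in>G. emeasure lborel (?B i))"
      using G by (subst sum_emeasure) (auto simp: G(3))
    also have "\<dots> = (\<Sum>i\<in>G. ennreal \<eta> * emeasure lborel (?B i))"
      by (simp add: sum_distrib_left)
    also have "\<dots> \<le> (\<Sum>i\<in>G. emeasure \<nu> (?B i))"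
    proof (rule sum_mono)
      fix i assume "i \<in> G"
      then have "i \<in> K"
        using G C by auto
      then have "0 < snd i" "\<eta> * (2 * snd i) < (LINT t:?B i|lborel. \<psi> t)"
        by (auto simp: K_def)
      then show "ennreal \<eta> * emeasure lborel (?B i) \<le> emeasure \<nu> (?B i)"
        using \<open>0 < \<eta>\<close>
        by (simp add: \<nu>_eq cball_eq_atLeastAtMost ennreal_mult[symmetric] ennreal_leI)
    qed
    also have "\<dots> = emeasure \<nu> (\<Union>F)"
      using G \<open>disjoint_family_on ?B G\<close> by (subst sum_emeasure) (auto simp: G(3))
    also have "\<dots> \<le> emeasure \<nu> U"
    proof (rule emeasure_mono)
      have "?B i \<subseteq> U" if "i \<in> K" for i
        using that by (auto simp: K_def)
      then show "\<Union>F \<subseteq> U"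
        using G C by blast
    qed (use U in auto)
    also have "\<dots> \<le> ennreal \<eta> * ennreal \<epsilon>"
      using \<nu>U \<open>0 < \<eta>\<close> \<open>0 < \<epsilon>\<close> by (simp add: ennreal_mult[symmetric])
    finally show "emeasure lborel (\<Union>F) \<le> ennreal \<epsilon>"
      using \<open>0 < \<eta>\<close> by (simp add: ennreal_mult_le_mult_iff)
  qed (use C in auto)
  moreover have meas: "\<Union>(?B ` C) \<in> sets borel"
    using C by (auto intro!: sets.countable_UN')
  ultimately have em: "emeasure lebesgue (\<Union>(?B ` C)) \<le> ennreal \<epsilon>"
    by simp
  have lm: "\<Union>(?B ` C) \<in> lmeasurable"
    using meas le_less_trans[OF em ennreal_less_top] by (intro fmeasurableI) simp_all
  have le: "measure lebesgue (\<Union>(?B ` C)) \<le> \<epsilon>"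
    unfolding measure_def using em \<open>0 < \<epsilon>\<close> by (intro enn2real_leI) auto
  have "\<exists>T. S \<subseteq> T \<and> T \<in> lmeasurable \<and> measure lebesgue T \<le> \<epsilon>"
  proof (intro exI conjI)
    \<comment> \<open>The selected balls cover \<open>S\<close> only up to a negligible set, which
      is adjoined to obtain a genuine superset.\<close>
    let ?T = "\<Union>(?B ` C) \<union> (S - \<Union>(?B ` C))"
    show "S \<subseteq> ?T"
      by blast
    show "?T \<in> lmeasurable"
      by (rule fmeasurable.Un[OF lm negligible_imp_measurable[OF neg]])
    have "measure lebesgue ?T = measure lebesgue (\<Union>(?B ` C))"
      by (rule measure_Un_null_set) (use neg fmeasurableD[OF lm] in \<open>simp_all add: negligible_iff_null_sets\<close>)
    then show "measure lebesgue ?T \<le> \<epsilon>"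
      using le by simp
  qed
  then show "\<exists>T. ?S \<subseteq> T \<and> T \<in> lmeasurable \<and> measure lebesgue T \<le> \<epsilon>"
    by (simp add: S_def)
qed

lemma set_integrable_lborel_subset:
  fixes \<phi> :: "real \<Rightarrow> real"
  assumes "integrable lborel \<phi>" "A \<in> sets borel"
  shows "set_integrable lborel A \<phi>"
  using assms unfolding set_integrable_def by (intro integrable_mult_indicator) auto

lemma indefinite_integral_diff:
  fixes \<phi> :: "real \<Rightarrow> real"
  assumes "integrable lborel \<phi>" "x \<le> y"
  shows "(LINT t:{..y}|lborel. \<phi> t) - (LINT t:{..x}|lborel. \<phi> t) = (LINT t:{x<..y}|lborel. \<phi> t)"
proof -
  have "{..y} = {..x} \<union> {x<..y}"
    using assms(2) by auto
  then have "(LINT t:{..y}|lborel. \<phi> t) = (LINT t:{..x}|lborel. \<phi> t) + (LINT t:{x<..y}|lborel. \<phi> t)"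
    using assms by (subst \<open>{..y} = _\<close>) (intro set_integral_Un set_integrable_lborel_subset; auto)
  then show ?thesis by simp
qed

lemma AE_upper_derivate_indefinite_integral_le:
  fixes \<phi> :: "real \<Rightarrow> real"
  assumes int: "integrable lborel \<phi>"
  defines "G \<equiv> \<lambda>y. LINT t:{..y}|lborel. \<phi> t"
  shows "AE x in lborel. \<forall>e>0. \<forall>\<^sub>F y in at x. (G y - G x) / (y - x) \<le> \<phi> x + e"
proof -
  have [measurable]: "\<phi> \<in> borel_measurable borel"
    using int by auto
  \<comment> \<open>The cutoff to \<open>[-N, N]\<close> keeps \<open>\<psi>\<close> integrable when
    \<open>p\<close> is negative. All parameters range over countable sets, so one null set serves
    for all of them.\<close>
  define \<psi> where "\<psi> N p t = indicator {- real N..real N} t * max 0 (\<phi> t - of_rat p)"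
    for N :: nat and p :: rat and t
  have \<psi>_int: "integrable lborel (\<psi> N p)" for N p
  proof -
    have "integrable lborel (\<lambda>t. indicator {- real N..real N} t *\<^sub>R (\<phi> t - of_rat p))"
      using set_integral_diff(1)[OF set_integrable_lborel_subset[OF int], of "{- real N..real N}" "\<lambda>_. of_rat p"]
      by (simp add: set_integrable_def)
    then have "integrable lborel (\<lambda>t. max 0 (indicator {- real N..real N} t *\<^sub>R (\<phi> t - of_rat p)))"
      by (intro integrable_max) auto
    moreover have "max 0 (indicator {- real N..real N} t *\<^sub>R (\<phi> t - of_rat p)) = \<psi> N p t" for t
      by (auto simp: \<psi>_def indicator_def)
    ultimately show ?thesis
      by simp
  qed
  define Z where "Z N p k = {x. \<psi> N p x = 0 \<and> (\<forall>R>0. \<exists>r. 0 < r \<and> r < R \<and>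
      inverse (real (Suc k)) * (2 * r) < (LINT t:cball x r|lborel. \<psi> N p t))}" for N p k
  have "negligible (Z N p k)" for N p k
    unfolding Z_def
    by (rule negligible_positive_upper_density_at_zeros[OF \<psi>_int]) (auto simp: \<psi>_def)
  then have "AE x in lborel. x \<notin> Z N p k" for N p k
    by (metis AE_completion_iff AE_not_in negligible_iff_null_sets)
  then have "AE x in lborel. \<forall>N p k. x \<notin> Z N p k"
    by (simp add: AE_all_countable)
  then show ?thesis
  proof (rule AE_mp, intro AE_I2 impI allI)
    fix x e :: real
    assume Z: "\<forall>N p k. x \<notin> Z N p k" and "0 < e"
    \<comment> \<open>The error \<open>e\<close> is split in two: \<open>p\<close> exceeds
      \<open>\<phi> x\<close> by less than \<open>e / 2\<close>, and a density below
      \<open>e / 4\<close> on a ball of length \<open>2 * (v - u)\<close> contributes at most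
      \<open>e / 2\<close> per unit of \<open>v - u\<close>. The choice of \<open>N\<close> keeps
      balls of radius below 1 around \<open>x\<close> inside the cutoff.\<close>
    obtain p where p: "\<phi> x < of_rat p" "of_rat p < \<phi> x + e / 2"
      using of_rat_dense[of "\<phi> x" "\<phi> x + e / 2"] \<open>0 < e\<close> by auto
    obtain k where k: "inverse (real (Suc k)) < e / 4"
      using reals_Archimedean[of "e / 4"] \<open>0 < e\<close> by auto
    obtain N :: nat where N: "\<bar>x\<bar> + 1 < real N"
      using reals_Archimedean2 by blast
    have "\<psi> N p x = 0"
      using p by (simp add: \<psi>_def)
    then have "\<not> (\<forall>R>0. \<exists>r. 0 < r \<and> r < R \<and>
        inverse (real (Suc k)) * (2 * r) < (LINT t:cball x r|lborel. \<psi> N p t))"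
      using Z by (simp add: Z_def)
    then obtain R where "0 < R" and R: "\<And>r. 0 < r \<Longrightarrow> r < R \<Longrightarrow>
        (LINT t:cball x r|lborel. \<psi> N p t) \<le> inverse (real (Suc k)) * (2 * r)"
      by (meson not_less)
    \<comment> \<open>Later used with \<open>x\<close> as the left or the right endpoint; passing to
      the ball centred at \<open>x\<close> only doubles the length, so both one-sided quotients are
      covered.\<close>
    have bound: "(LINT t:{u<..v}|lborel. \<phi> t) \<le> (\<phi> x + e) * (v - u)"
      if uv: "u < v" "{u<..v} \<subseteq> cball x (v - u)" "v - u < R" "v - u < 1" for u v
    proof -
      have c: "set_integrable lborel {u<..v} (\<lambda>_. of_rat p :: real)"
        using uv(1) by (simp add: set_integrable_def)
      have "(LINT t:{u<..v}|lborel. \<phi> t) - of_rat p * (v - u)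
          = (LINT t:{u<..v}|lborel. \<phi> t - of_rat p)"
        using uv(1) set_integral_diff(2)[OF set_integrable_lborel_subset[OF int] c]
        by (simp add: set_integrable_def set_lebesgue_integral_def mult.commute)
      also have "\<dots> \<le> (LINT t:cball x (v - u)|lborel. \<psi> N p t)"
        unfolding set_lebesgue_integral_def
      proof (rule integral_mono)
        show "integrable lborel (\<lambda>t. indicator {u<..v} t *\<^sub>R (\<phi> t - of_rat p))"
          using set_integral_diff(1)[OF set_integrable_lborel_subset[OF int] c]
          by (simp add: set_integrable_def)
        show "integrable lborel (\<lambda>t. indicator (cball x (v - u)) t *\<^sub>R \<psi> N p t)"
          using set_integrable_lborel_subset[OF \<psi>_int] by (simp add: set_integrable_def)
        fix t
        show "indicator {u<..v} t *\<^sub>R (\<phi> t - of_rat p) \<le> indicator (cball x (v - u)) t *\<^sub>R \<psi> N p t"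
        proof (cases "t \<in> {u<..v}")
          case True
          then have "\<bar>x - t\<bar> \<le> v - u"
            using uv(2) by (auto simp: dist_real_def)
          then have "t \<in> {- real N..real N}" "t \<in> cball x (v - u)"
            using uv(4) N by (auto simp: dist_real_def)
          then show ?thesis
            using True by (simp add: \<psi>_def)
        next
          case False
          then show ?thesis
            by (simp add: \<psi>_def)
        qed
      qed
      also have "\<dots> \<le> inverse (real (Suc k)) * (2 * (v - u))"
        using uv by (intro R) auto
      also have "\<dots> \<le> e / 4 * (2 * (v - u))"
        using k uv(1) by (intro mult_right_mono) auto
      finally have "(LINT t:{u<..v}|lborel. \<phi> t) \<le> (of_rat p + e / 2) * (v - u)"
        by (simp add: field_simps)
      also have "\<dots> \<le> (\<phi> x + e) * (v - u)"
        using p uv(1) by (intro mult_right_mono) auto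
      finally show ?thesis .
    qed
    have "(G y - G x) / (y - x) \<le> \<phi> x + e" if y: "y \<noteq> x" "dist y x < min R 1" for y
    proof (cases "x < y")
      case True
      then have "G y - G x \<le> (\<phi> x + e) * (y - x)"
        unfolding G_def indefinite_integral_diff[OF int less_imp_le[OF True]]
        using y by (intro bound) (auto simp: dist_real_def)
      then show ?thesis
        using True by (simp add: divide_le_eq)
    next
      case False
      then have "y < x"
        using y by auto
      then have "G x - G y \<le> (\<phi> x + e) * (x - y)"
        unfolding G_def indefinite_integral_diff[OF int less_imp_le[OF \<open>y < x\<close>]]
        using y \<open>y < x\<close> by (intro bound) (auto simp: dist_real_def)
      moreover have "(G y - G x) / (y - x) = (G x - G y) / (x - y)"
        by (metis minus_diff_eq minus_divide_divide)
      ultimately show ?thesis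
        using \<open>y < x\<close> by (simp add: divide_le_eq)
    qed
    then show "\<forall>\<^sub>F y in at x. (G y - G x) / (y - x) \<le> \<phi> x + e"
      unfolding eventually_at using \<open>0 < R\<close> by (intro exI[of _ "min R 1"]) auto
  qed
qed

text \<open>The bound on upper derivates, applied to \<open>\<phi>\<close> and to
  \<open>- \<phi>\<close>, squeezes the difference quotient from both sides.\<close>

theorem lebesgue_differentiation_real:
  fixes \<phi> :: "real \<Rightarrow> real"
  assumes int: "integrable lborel \<phi>"
  shows "AE x in lborel. ((\<lambda>y. LINT t:{..y}|lborel. \<phi> t) has_real_derivative \<phi> x) (at x)"
proof -
  define G where "G = (\<lambda>y. LINT t:{..y}|lborel. \<phi> t)"
  have neg: "(LINT t:{..y}|lborel. - \<phi> t) = - G y" for y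
    by (simp add: G_def set_lebesgue_integral_def)
  have "AE x in lborel. \<forall>e>0. \<forall>\<^sub>F y in at x. (G y - G x) / (y - x) \<le> \<phi> x + e"
    using AE_upper_derivate_indefinite_integral_le[OF int] by (simp add: G_def)
  moreover have "AE x in lborel. \<forall>e>0. \<forall>\<^sub>F y in at x. (- G y - - G x) / (y - x) \<le> - \<phi> x + e"
    using AE_upper_derivate_indefinite_integral_le[of "\<lambda>x. - \<phi> x"] int by (simp add: neg)
  ultimately have "AE x in lborel. (G has_real_derivative \<phi> x) (at x)"
  proof eventually_elim
    case (elim x)
    have "((\<lambda>y. (G y - G x) / (y - x)) \<longlongrightarrow> \<phi> x) (at x)"
    proof (rule tendstoI)
      fix e :: real assume "0 < e"
      then have "\<forall>\<^sub>F y in at x. (G y - G x) / (y - x) \<le> \<phi> x + e / 2"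
        "\<forall>\<^sub>F y in at x. (- G y - - G x) / (y - x) \<le> - \<phi> x + e / 2"
        using elim by (auto simp del: minus_diff_minus)
      then show "\<forall>\<^sub>F y in at x. dist ((G y - G x) / (y - x)) (\<phi> x) < e"
      proof eventually_elim
        case (elim y)
        have "(- G y - - G x) / (y - x) = - ((G y - G x) / (y - x))"
          by (simp add: minus_divide_left)
        then show ?case
          using elim \<open>0 < e\<close> unfolding dist_real_def by linarith
      qed
    qed
    then show ?case
      by (simp add: has_field_derivative_iff)
  qed
  then show ?thesis
    by (simp add: G_def)
qed

section \<open>Absolutely continuous functions\<close>

text \<open>The index type stays free: families are later indexed by numbers, by pairs of numbers
  and by the intervals themselves. Degenerate intervals are allowed, so that cutting a family at a
  point never forces members to be discarded.\<close>

definition interval_family :: "'i set \<Rightarrow> ('i \<Rightarrow> real) \<Rightarrow> ('i \<Rightarrow> real) \<Rightarrow> bool" where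
  "interval_family I u v \<longleftrightarrow>
    finite I \<and> (\<forall>i\<in>I. u i \<le> v i) \<and> disjoint_family_on (\<lambda>i. {u i<..<v i}) I"

text \<open>Absolute continuity uniformly on the whole line. It is preserved under extending a function
  constantly beyond an interval, which turns local statements into global ones.\<close>

definition abs_cont :: "(real \<Rightarrow> real) \<Rightarrow> bool" where
  "abs_cont g \<longleftrightarrow> (\<forall>e>0. \<exists>d>0. \<forall>(n::nat) u v.
     interval_family {..<n} u v \<longrightarrow> (\<Sum>i<n. v i - u i) < d \<longrightarrow> (\<Sum>i<n. \<bar>g (v i) - g (u i)\<bar>) < e)"

lemma interval_family_mono_map:
  assumes "interval_family I u v" and "mono k"
    and "\<And>i. i \<in> I \<Longrightarrow> {k (u i)<..<k (v i)} \<subseteq> {u i<..<v i}"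
  shows "interval_family I (\<lambda>i. k (u i)) (\<lambda>i. k (v i))"
  unfolding interval_family_def
proof (intro conjI ballI)
  show "finite I"
    using assms(1) by (simp add: interval_family_def)
  show "k (u i) \<le> k (v i)" if "i \<in> I" for i
    using assms(1,2) that by (simp add: interval_family_def monoD)
  have "disjoint_family_on (\<lambda>i. {u i<..<v i}) I"
    using assms(1) by (simp add: interval_family_def)
  then show "disjoint_family_on (\<lambda>i. {k (u i)<..<k (v i)}) I"
    using assms(3) unfolding disjoint_family_on_def by blast
qed

text \<open>Together with its counterpart for \<open>min\<close>, this cuts a family at
  \<open>t\<close>: an interval on the wrong side collapses to a point and contributes nothing to
  any sum of increments.\<close>

lemma interval_family_max:
  assumes "interval_family I u v"
  shows "interval_family I (\<lambda>i. max t (u i)) (\<lambda>i. max t (v i))"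
  using assms by (rule interval_family_mono_map) (auto simp: mono_def)

lemma interval_family_min:
  assumes "interval_family I u v"
  shows "interval_family I (\<lambda>i. min t (u i)) (\<lambda>i. min t (v i))"
  using assms by (rule interval_family_mono_map) (auto simp: mono_def)

lemma interval_family_enumerate:
  assumes "interval_family I u v"
  obtains h where "bij_betw h {..<card I} I" "interval_family {..<card I} (\<lambda>j. u (h j)) (\<lambda>j. v (h j))"
proof -
  obtain h where h: "bij_betw h {..<card I} I"
    using ex_bij_betw_nat_finite[of I] assms by (auto simp: interval_family_def atLeast0LessThan)
  then have inj: "inj_on h {..<card I}" and h_in: "\<And>j. j \<in> {..<card I} \<Longrightarrow> h j \<in> I"
    using bij_betw_imp_inj_on bij_betwE by blast+
  have "interval_family {..<card I} (\<lambda>j. u (h j)) (\<lambda>j. v (h j))"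
    unfolding interval_family_def disjoint_family_on_def
  proof (intro conjI ballI impI)
    fix j k assume "j \<in> {..<card I}" "k \<in> {..<card I}" "j \<noteq> k"
    then have "h j \<in> I" "h k \<in> I" "h j \<noteq> h k"
      using inj h_in by (auto dest: inj_onD)
    then show "{u (h j)<..<v (h j)} \<inter> {u (h k)<..<v (h k)} = {}"
      using assms unfolding interval_family_def disjoint_family_on_def by blast
  next
    fix j assume "j \<in> {..<card I}"
    then show "u (h j) \<le> v (h j)"
      using assms h_in unfolding interval_family_def by blast
  qed simp
  with h show thesis
    by (rule that)
qed

lemma sum_interval_family_le_emeasure:
  assumes fam: "interval_family I u v" and sub: "\<And>i. i \<in> I \<Longrightarrow> {u i<..<v i} \<subseteq> B"
    and B: "B \<in> sets borel"
  shows "ennreal (\<Sum>i\<in>I. v i - u i) \<le> emeasure lborel B"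
proof -
  have "ennreal (\<Sum>i\<in>I. v i - u i) = (\<Sum>i\<in>I. emeasure lborel {u i<..<v i})"
    using fam by (subst sum_ennreal[symmetric]) (auto simp: interval_family_def intro!: sum.cong)
  also have "\<dots> = emeasure lborel (\<Union>i\<in>I. {u i<..<v i})"
    using fam by (intro sum_emeasure) (auto simp: interval_family_def)
  also have "\<dots> \<le> emeasure lborel B"
    using sub B by (intro emeasure_mono) auto
  finally show ?thesis .
qed

lemma sum_interval_family_le:
  assumes fam: "interval_family I u v" and sub: "\<And>i. i \<in> I \<Longrightarrow> a \<le> u i \<and> v i \<le> b" and "a \<le> b"
  shows "(\<Sum>i\<in>I. v i - u i) \<le> b - a"
proof -
  have "{u i<..<v i} \<subseteq> {a..b}" if "i \<in> I" for i
    using sub[OF that] by auto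
  from sum_interval_family_le_emeasure[OF fam this]
  have "ennreal (\<Sum>i\<in>I. v i - u i) \<le> ennreal (b - a)"
    using \<open>a \<le> b\<close> by simp
  then show ?thesis
    using \<open>a \<le> b\<close> by (simp add: ennreal_le_iff)
qed

text \<open>A definition cannot quantify over index types, so \<open>abs_cont\<close> speaks of
  families indexed by numbers; enumerating a finite index set carries the same \<open>d\<close> over
  to any type.\<close>

lemma abs_contD:
  assumes "abs_cont g" "0 < e"
  obtains d where "0 < d" "\<forall>(I :: 'i set) u v. interval_family I u v \<longrightarrow> (\<Sum>i\<in>I. v i - u i) < d \<longrightarrow>
    (\<Sum>i\<in>I. \<bar>g (v i) - g (u i)\<bar>) < e"
proof -
  obtain d where "0 < d" and d: "\<And>(n::nat) u v. interval_family {..<n} u v \<Longrightarrow> (\<Sum>i<n. v i - u i) < d \<Longrightarrow>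
    (\<Sum>i<n. \<bar>g (v i) - g (u i)\<bar>) < e"
    using assms unfolding abs_cont_def by blast
  have "(\<Sum>i\<in>I. \<bar>g (v i) - g (u i)\<bar>) < e"
    if fam: "interval_family I u v" and less: "(\<Sum>i\<in>I. v i - u i) < d" for I :: "'i set" and u v
  proof -
    from fam obtain h where h: "bij_betw h {..<card I} I"
      and fam': "interval_family {..<card I} (\<lambda>j. u (h j)) (\<lambda>j. v (h j))"
      by (rule interval_family_enumerate)
    show ?thesis
      using d[OF fam'] less sum.reindex_bij_betw[OF h, of "\<lambda>i. v i - u i"]
        sum.reindex_bij_betw[OF h, of "\<lambda>i. \<bar>g (v i) - g (u i)\<bar>"]
      by simp
  qed
  with \<open>0 < d\<close> show thesis
    by (intro that) blast+
qed

lemma abs_cont_diff: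
  assumes "abs_cont f" "abs_cont g"
  shows "abs_cont (\<lambda>x. f x - g x)"
  unfolding abs_cont_def
proof (intro allI impI)
  fix e :: real assume "0 < e"
  then have "0 < e / 2" by simp
  obtain d1 where d1: "0 < d1" "\<forall>(I :: nat set) u v. interval_family I u v \<longrightarrow> (\<Sum>i\<in>I. v i - u i) < d1 \<longrightarrow>
    (\<Sum>i\<in>I. \<bar>f (v i) - f (u i)\<bar>) < e / 2"
    by (rule abs_contD[where 'i=nat, OF assms(1) \<open>0 < e / 2\<close>])
  obtain d2 where d2: "0 < d2" "\<forall>(I :: nat set) u v. interval_family I u v \<longrightarrow> (\<Sum>i\<in>I. v i - u i) < d2 \<longrightarrow>
    (\<Sum>i\<in>I. \<bar>g (v i) - g (u i)\<bar>) < e / 2"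
    by (rule abs_contD[where 'i=nat, OF assms(2) \<open>0 < e / 2\<close>])
  have "(\<Sum>i<n. \<bar>f (v i) - g (v i) - (f (u i) - g (u i))\<bar>) < e"
    if "interval_family {..<n} u v" "(\<Sum>i<n. v i - u i) < min d1 d2" for n :: nat and u v
  proof -
    have "(\<Sum>i<n. \<bar>f (v i) - g (v i) - (f (u i) - g (u i))\<bar>)
        \<le> (\<Sum>i<n. \<bar>f (v i) - f (u i)\<bar> + \<bar>g (v i) - g (u i)\<bar>)"
      by (intro sum_mono) auto
    also have "\<dots> < e"
      using d1(2)[rule_format, OF that(1)] d2(2)[rule_format, OF that(1)] that(2) by (simp add: sum.distrib)
    finally show ?thesis .
  qed
  then show "\<exists>d>0. \<forall>(n::nat) u v. interval_family {..<n} u v \<longrightarrow> (\<Sum>i<n. v i - u i) < d \<longrightarrow>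
      (\<Sum>i<n. \<bar>f (v i) - g (v i) - (f (u i) - g (u i))\<bar>) < e"
    using d1(1) d2(1) by (intro exI[of _ "min d1 d2"]) auto
qed

text \<open>Clamping is monotone and 1-Lipschitz: it moves a family into \<open>[c, d]\<close>,
  keeps the open intervals disjoint and does not increase their total length.\<close>

lemma abs_cont_clamp:
  assumes ac: "absolutely_continuous_on_interval c d g" and "c \<le> d"
  shows "abs_cont (\<lambda>x. g (max c (min d x)))"
  unfolding abs_cont_def
proof (intro allI impI)
  fix e :: real assume "0 < e"
  let ?k = "\<lambda>x. max c (min d x)"
  obtain \<delta> where "0 < \<delta>" and \<delta>: "\<forall>(n::nat) u v.
       (\<forall>i<n. c \<le> u i \<and> u i \<le> v i \<and> v i \<le> d) \<and>
       disjoint_family_on (\<lambda>i. {u i<..<v i}) {..<n} \<and> (\<Sum>i<n. v i - u i) < \<delta> \<longrightarrow>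
       (\<Sum>i<n. \<bar>g (v i) - g (u i)\<bar>) < e"
    using ac[unfolded absolutely_continuous_on_interval_def, rule_format, OF \<open>0 < e\<close>] by blast
  have "(\<Sum>i<n. \<bar>g (?k (v i)) - g (?k (u i))\<bar>) < e"
    if fam: "interval_family {..<n} u v" and less: "(\<Sum>i<n. v i - u i) < \<delta>" for n :: nat and u v
  proof (rule \<delta>[rule_format], intro conjI)
    have "interval_family {..<n} (\<lambda>i. ?k (u i)) (\<lambda>i. ?k (v i))"
      using fam by (intro interval_family_max interval_family_min)
    then show "disjoint_family_on (\<lambda>i. {?k (u i)<..<?k (v i)}) {..<n}"
      "\<forall>i<n. c \<le> ?k (u i) \<and> ?k (u i) \<le> ?k (v i) \<and> ?k (v i) \<le> d"
      using \<open>c \<le> d\<close> unfolding interval_family_def by auto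
    have "?k y - ?k x \<le> y - x" if "x \<le> y" for x y
      using that by linarith
    then have "(\<Sum>i<n. ?k (v i) - ?k (u i)) \<le> (\<Sum>i<n. v i - u i)"
      using fam unfolding interval_family_def by (intro sum_mono) auto
    then show "(\<Sum>i<n. ?k (v i) - ?k (u i)) < \<delta>"
      using less by linarith
  qed
  then show "\<exists>d'>0. \<forall>(n::nat) u v. interval_family {..<n} u v \<longrightarrow> (\<Sum>i<n. v i - u i) < d' \<longrightarrow>
      (\<Sum>i<n. \<bar>g (?k (v i)) - g (?k (u i))\<bar>) < e"
    using \<open>0 < \<delta>\<close> by auto
qed

lemma abs_cont_imp_continuous:
  assumes "abs_cont g"
  shows "continuous_on UNIV g"
  unfolding continuous_on_iff
proof (intro ballI allI impI)
  fix x e :: real assume "0 < e"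
  obtain d where d: "0 < d" "\<forall>(I :: unit set) u v. interval_family I u v \<longrightarrow> (\<Sum>i\<in>I. v i - u i) < d \<longrightarrow>
    (\<Sum>i\<in>I. \<bar>g (v i) - g (u i)\<bar>) < e"
    by (rule abs_contD[where 'i=unit, OF assms \<open>0 < e\<close>])
  have close: "\<bar>g y - g x\<bar> < e" if "x \<le> y" "y - x < d" for x y
    using d(2)[rule_format, of UNIV "\<lambda>_. x" "\<lambda>_. y"] that
    by (simp add: interval_family_def disjoint_family_on_def)
  have "dist (g y) (g x) < e" if "dist y x < d" for y
    using close[of x y] close[of y x] that by (cases "x \<le> y") (auto simp: dist_real_def)
  with d(1) show "\<exists>d>0. \<forall>y\<in>UNIV. dist y x < d \<longrightarrow> dist (g y) (g x) < e"
    by blast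
qed

text \<open>The half-line to the right of \<open>c\<close> is cut into steps of length
  \<open>d / 2\<close>. What a family has inside one step is shorter than \<open>d\<close> and
  contributes less than 1, while nothing comes from the left of \<open>c\<close>, where
  \<open>g\<close> is constant; so \<open>k\<close> steps give at most \<open>k\<close>.\<close>

lemma abs_cont_bounded_sums:
  assumes ac: "abs_cont g" and const: "\<And>x. x \<le> c \<Longrightarrow> g x = g c"
  obtains B where "\<forall>(n::nat) u v. interval_family {..<n} u v \<longrightarrow> (\<forall>i<n. v i \<le> x) \<longrightarrow>
    (\<Sum>i<n. g (v i) - g (u i)) \<le> B"
proof -
  obtain d where d: "0 < d" "\<forall>(I :: nat set) u v. interval_family I u v \<longrightarrow> (\<Sum>i\<in>I. v i - u i) < d \<longrightarrow>
    (\<Sum>i\<in>I. \<bar>g (v i) - g (u i)\<bar>) < 1"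
    by (rule abs_contD[where 'i=nat, OF ac zero_less_one])
  have bound: "(\<Sum>i<n. g (v i) - g (u i)) \<le> real k"
    if "interval_family {..<n} u v" "\<And>i. i < n \<Longrightarrow> v i \<le> c + real k * (d / 2)" for k n :: nat and u v
    using that
  proof (induction k arbitrary: u v)
    case 0
    have "g (v i) - g (u i) = 0" if "i < n" for i
    proof -
      have "u i \<le> v i" "v i \<le> c"
        using 0 that by (auto simp: interval_family_def)
      then show ?thesis
        using const[of "v i"] const[of "u i"] by simp
    qed
    then show ?case
      by simp
  next
    case (Suc k)
    define t where "t = c + real k * (d / 2)"
    have split: "g (v i) - g (u i) = (g (min t (v i)) - g (min t (u i))) + (g (max t (v i)) - g (max t (u i)))" for i
      by (auto simp: min_def max_def)
    have "(\<Sum>i<n. g (min t (v i)) - g (min t (u i))) \<le> real k"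
      using Suc.prems(1) by (intro Suc.IH interval_family_min) (auto simp: t_def)
    moreover have "(\<Sum>i<n. \<bar>g (max t (v i)) - g (max t (u i))\<bar>) < 1"
    proof (rule d(2)[rule_format])
      show fam: "interval_family {..<n} (\<lambda>i. max t (u i)) (\<lambda>i. max t (v i))"
        using Suc.prems(1) by (rule interval_family_max)
      have "(\<Sum>i<n. max t (v i) - max t (u i)) \<le> (t + d / 2) - t"
      proof (rule sum_interval_family_le[OF fam])
        fix i assume "i \<in> {..<n}"
        then have "v i \<le> c + real (Suc k) * (d / 2)"
          using Suc.prems(2) by auto
        also have "\<dots> = t + d / 2"
          by (simp add: t_def algebra_simps)
        finally show "t \<le> max t (u i) \<and> max t (v i) \<le> t + d / 2"
          using d(1) by auto
      qed (use d(1) in simp)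
      then show "(\<Sum>i<n. max t (v i) - max t (u i)) < d"
        using d(1) by simp
    qed
    moreover have "(\<Sum>i<n. g (max t (v i)) - g (max t (u i))) \<le> (\<Sum>i<n. \<bar>g (max t (v i)) - g (max t (u i))\<bar>)"
      by (intro sum_mono) auto
    moreover have "(\<Sum>i<n. g (v i) - g (u i)) =
        (\<Sum>i<n. g (min t (v i)) - g (min t (u i))) + (\<Sum>i<n. g (max t (v i)) - g (max t (u i)))"
      unfolding sum.distrib[symmetric] by (intro sum.cong refl split)
    ultimately show ?case
      by simp
  qed
  obtain k :: nat where "(x - c) / (d / 2) < real k"
    using reals_Archimedean2 by blast
  then have k: "x \<le> c + real k * (d / 2)"
    using d(1) by (simp add: field_simps)
  show thesis
    by (rule that[of "real k"], intro allI impI, rule bound) (use k in \<open>auto intro: order_trans\<close>)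
qed


section \<open>Positive variation and the Jordan decomposition\<close>

definition variation_sums :: "(real \<Rightarrow> real) \<Rightarrow> real \<Rightarrow> real set" where
  "variation_sums g x = {\<Sum>i<n. g (v i) - g (u i) |n u v.
     interval_family {..<n::nat} u v \<and> (\<forall>i<n. v i \<le> x)}"

text \<open>The increasing part in the Jordan decomposition, measured from minus infinity. The sums
  are signed, but a family may leave gaps, so a stretch where \<open>g\<close> decreases is simply
  omitted.\<close>

definition positive_variation :: "(real \<Rightarrow> real) \<Rightarrow> real \<Rightarrow> real" where
  "positive_variation g x = Sup (variation_sums g x)"

lemma variation_sums_nonempty: "variation_sums g x \<noteq> {}"
proof -
  have "0 \<in> variation_sums g x"
    unfolding variation_sums_def
    by (intro CollectI exI[of _ 0]) (simp add: interval_family_def disjoint_family_on_def)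
  then show ?thesis
    by blast
qed

lemma variation_sumsI:
  assumes "interval_family {..<n::nat} u v" "\<And>i. i < n \<Longrightarrow> v i \<le> x"
  shows "(\<Sum>i<n. g (v i) - g (u i)) \<in> variation_sums g x"
  using assms unfolding variation_sums_def by blast

context
  fixes g :: "real \<Rightarrow> real"
  assumes bdd: "\<And>x. bdd_above (variation_sums g x)"
begin

lemma positive_variation_upper:
  assumes "interval_family {..<n::nat} u v" "\<And>i. i < n \<Longrightarrow> v i \<le> x"
  shows "(\<Sum>i<n. g (v i) - g (u i)) \<le> positive_variation g x"
  unfolding positive_variation_def
  using variation_sumsI[OF assms] bdd by (rule cSup_upper)

lemma mono_positive_variation: "mono (positive_variation g)"
proof (rule monoI)
  fix x y :: real assume "x \<le> y"
  have "variation_sums g x \<subseteq> variation_sums g y"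
  proof
    fix s assume "s \<in> variation_sums g x"
    then obtain n u v where fam: "interval_family {..<n::nat} u v" and "\<And>i. i < n \<Longrightarrow> v i \<le> x"
      and s: "s = (\<Sum>i<n. g (v i) - g (u i))"
      unfolding variation_sums_def by blast
    then have "\<And>i. i < n \<Longrightarrow> v i \<le> y"
      using \<open>x \<le> y\<close> by (meson order_trans)
    from variation_sumsI[OF fam this] show "s \<in> variation_sums g y"
      by (simp add: s)
  qed
  then show "positive_variation g x \<le> positive_variation g y"
    unfolding positive_variation_def by (intro cSup_subset_mono variation_sums_nonempty bdd)
qed

text \<open>Appending the interval from \<open>x\<close> to \<open>y\<close> to a family that ends
  by \<open>x\<close> gives a family that ends by \<open>y\<close>. This is what makes
  \<open>positive_variation g - g\<close> monotone.\<close>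

lemma positive_variation_diff_ge:
  assumes "x \<le> y"
  shows "g y - g x \<le> positive_variation g y - positive_variation g x"
proof -
  have "positive_variation g x \<le> positive_variation g y - (g y - g x)"
    unfolding positive_variation_def[of g x]
  proof (rule cSup_least[OF variation_sums_nonempty])
    fix s assume "s \<in> variation_sums g x"
    then obtain n u v where fam: "interval_family {..<n::nat} u v" and vx: "\<And>i. i < n \<Longrightarrow> v i \<le> x"
      and s: "s = (\<Sum>i<n. g (v i) - g (u i))"
      unfolding variation_sums_def by blast
    let ?u = "u(n := x)" and ?v = "v(n := y)"
    have "interval_family {..<Suc n} ?u ?v"
      unfolding interval_family_def disjoint_family_on_def
    proof (intro conjI ballI impI)
      show "?u i \<le> ?v i" if "i \<in> {..<Suc n}" for i
        using that fam \<open>x \<le> y\<close> by (auto simp: interval_family_def)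
      fix i j assume ij: "i \<in> {..<Suc n}" "j \<in> {..<Suc n}" "i \<noteq> j"
      then consider "i < n" "j < n" | "i < n" "j = n" | "i = n" "j < n"
        by fastforce
      then show "{?u i<..<?v i} \<inter> {?u j<..<?v j} = {}"
      proof cases
        case 1
        have "{u i<..<v i} \<inter> {u j<..<v j} = {}"
          using fam 1 ij(3) unfolding interval_family_def disjoint_family_on_def by blast
        with 1 show ?thesis
          by simp
      next
        case 2
        then show ?thesis
          using vx[of i] by auto
      next
        case 3
        then show ?thesis
          using vx[of j] by auto
      qed
    qed simp
    then have "(\<Sum>i<Suc n. g (?v i) - g (?u i)) \<le> positive_variation g y"
      by (rule positive_variation_upper) (use vx \<open>x \<le> y\<close> in \<open>force simp: less_Suc_eq\<close>)
    moreover have "(\<Sum>i<Suc n. g (?v i) - g (?u i)) = s + (g y - g x)"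
      by (simp add: s)
    ultimately show "s \<le> positive_variation g y - (g y - g x)"
      by simp
  qed
  then show ?thesis
    by simp
qed

text \<open>A nearly optimal family up to \<open>y\<close> is cut at \<open>x\<close>. Its left part
  counts for at most \<open>positive_variation g x\<close>, so the right part alone nearly attains
  the increment.\<close>

lemma positive_variation_approx:
  assumes "x \<le> y" "0 < e"
  obtains n :: nat and u v where "interval_family {..<n} u v" "\<forall>i<n. x \<le> u i \<and> v i \<le> y"
    "positive_variation g y - positive_variation g x \<le> (\<Sum>i<n. g (v i) - g (u i)) + e"
proof -
  have "positive_variation g y - e < Sup (variation_sums g y)"
    using \<open>0 < e\<close> by (simp add: positive_variation_def)
  then obtain s where "s \<in> variation_sums g y" "positive_variation g y - e < s"
    using less_cSup_iff[OF variation_sums_nonempty bdd] by blast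
  then obtain n u v where fam: "interval_family {..<n::nat} u v" and vy: "\<And>i. i < n \<Longrightarrow> v i \<le> y"
    and s: "positive_variation g y - e < (\<Sum>i<n. g (v i) - g (u i))"
    unfolding variation_sums_def by blast
  have split: "g (v i) - g (u i) = (g (min x (v i)) - g (min x (u i))) + (g (max x (v i)) - g (max x (u i)))" for i
    by (auto simp: min_def max_def)
  have "(\<Sum>i<n. g (min x (v i)) - g (min x (u i))) \<le> positive_variation g x"
    by (intro positive_variation_upper interval_family_min fam) auto
  moreover have "(\<Sum>i<n. g (v i) - g (u i)) =
      (\<Sum>i<n. g (min x (v i)) - g (min x (u i))) + (\<Sum>i<n. g (max x (v i)) - g (max x (u i)))"
    unfolding sum.distrib[symmetric] by (intro sum.cong refl split)
  ultimately have "positive_variation g y - positive_variation g x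
      \<le> (\<Sum>i<n. g (max x (v i)) - g (max x (u i))) + e"
    using s by linarith
  then show thesis
    using vy \<open>x \<le> y\<close> by (intro that[OF interval_family_max[OF fam]]) auto
qed

text \<open>Each given interval is filled with a subfamily that nearly attains the increment of the
  positive variation. All of them together form one family of no greater total length, to which the
  absolute continuity of \<open>g\<close> applies.\<close>

lemma abs_cont_positive_variation:
  assumes ac: "abs_cont g"
  shows "abs_cont (positive_variation g)"
  unfolding abs_cont_def
proof (intro allI impI)
  fix e :: real assume "0 < e"
  then have "0 < e / 2" by simp
  let ?p = "positive_variation g"
  obtain d where d: "0 < d" "\<forall>(I :: (nat \<times> nat) set) u v. interval_family I u v \<longrightarrow>
    (\<Sum>i\<in>I. v i - u i) < d \<longrightarrow> (\<Sum>i\<in>I. \<bar>g (v i) - g (u i)\<bar>) < e / 2"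
    by (rule abs_contD[where 'i="nat \<times> nat", OF ac \<open>0 < e / 2\<close>])
  have "(\<Sum>i<n. \<bar>?p (v i) - ?p (u i)\<bar>) < e"
    if fam: "interval_family {..<n} u v" and less: "(\<Sum>i<n. v i - u i) < d" for n :: nat and u v
  proof -
    \<comment> \<open>The \<open>n\<close> approximation errors add up to at most
      \<open>e / 2\<close>; the summand 1 covers \<open>n = 0\<close>.\<close>
    define r where "r = e / (2 * (real n + 1))"
    have "0 < r"
      using \<open>0 < e\<close> by (simp add: r_def)
    define P where "P i N U V \<longleftrightarrow> interval_family {..<N} U V \<and> (\<forall>j<N. u i \<le> U j \<and> V j \<le> v i) \<and>
        ?p (v i) - ?p (u i) \<le> (\<Sum>j<N. g (V j) - g (U j)) + r" for i and N :: nat and U V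
    have "\<exists>N U V. P i N U V" if "i < n" for i
    proof -
      have "u i \<le> v i"
        using fam that by (simp add: interval_family_def)
      from positive_variation_approx[OF this \<open>0 < r\<close>] show ?thesis
        unfolding P_def by metis
    qed
    then obtain N U V where "\<And>i. i < n \<Longrightarrow> P i (N i) (U i) (V i)"
      by metis
    then have sub: "\<And>i. i < n \<Longrightarrow> interval_family {..<N i} (U i) (V i)"
      and within: "\<And>i j. i < n \<Longrightarrow> j < N i \<Longrightarrow> u i \<le> U i j \<and> V i j \<le> v i"
      and approx: "\<And>i. i < n \<Longrightarrow> ?p (v i) - ?p (u i) \<le> (\<Sum>j<N i. g (V i j) - g (U i j)) + r"
      unfolding P_def by blast+
    define I where "I = (SIGMA i:{..<n}. {..<N i})"
    let ?U = "\<lambda>(i, j). U i j" and ?V = "\<lambda>(i, j). V i j"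
    have Sigma: "(\<Sum>i<n. \<Sum>j<N i. f i j) = (\<Sum>k\<in>I. case k of (i, j) \<Rightarrow> f i j)" for f :: "nat \<Rightarrow> nat \<Rightarrow> real"
      unfolding I_def by (rule sum.Sigma) auto
    have famI: "interval_family I ?U ?V"
      unfolding interval_family_def disjoint_family_on_def
    proof (intro conjI ballI impI)
      show "finite I"
        by (simp add: I_def)
      show "?U k \<le> ?V k" if "k \<in> I" for k
        using that sub by (auto simp: I_def interval_family_def)
      fix k l assume k: "k \<in> I" and l: "l \<in> I" and "k \<noteq> l"
      obtain i j i' j' where kl: "k = (i, j)" "l = (i', j')"
        by fastforce
      have ij: "i < n" "j < N i" "i' < n" "j' < N i'"
        using k l by (auto simp: I_def kl)
      show "{?U k<..<?V k} \<inter> {?U l<..<?V l} = {}"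
      proof (cases "i = i'")
        case True
        then have "{U i j<..<V i j} \<inter> {U i j'<..<V i j'} = {}"
          using sub[OF ij(1)] ij \<open>k \<noteq> l\<close> kl unfolding interval_family_def disjoint_family_on_def by auto
        then show ?thesis
          using True by (simp add: kl)
      next
        case False
        then have "{u i<..<v i} \<inter> {u i'<..<v i'} = {}"
          using fam ij unfolding interval_family_def disjoint_family_on_def by blast
        moreover have "{U i j<..<V i j} \<subseteq> {u i<..<v i}" "{U i' j'<..<V i' j'} \<subseteq> {u i'<..<v i'}"
          using within[OF ij(1,2)] within[OF ij(3,4)] by auto
        ultimately show ?thesis
          unfolding kl prod.case by blast
      qed
    qed
    have "(\<Sum>k\<in>I. ?V k - ?U k) = (\<Sum>i<n. \<Sum>j<N i. V i j - U i j)"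
      unfolding Sigma by (intro sum.cong) auto
    also have "\<dots> \<le> (\<Sum>i<n. v i - u i)"
    proof (rule sum_mono)
      fix i assume "i \<in> {..<n}"
      then have "i < n" by simp
      moreover from this have "u i \<le> v i"
        using fam by (simp add: interval_family_def)
      ultimately show "(\<Sum>j<N i. V i j - U i j) \<le> v i - u i"
        using sub within by (intro sum_interval_family_le) auto
    qed
    finally have "(\<Sum>k\<in>I. ?V k - ?U k) < d"
      using less by linarith
    then have I_less: "(\<Sum>k\<in>I. \<bar>g (?V k) - g (?U k)\<bar>) < e / 2"
      using d(2)[rule_format, OF famI] by blast
    have "(\<Sum>i<n. \<bar>?p (v i) - ?p (u i)\<bar>) \<le> (\<Sum>i<n. (\<Sum>j<N i. g (V i j) - g (U i j)) + r)"
    proof (rule sum_mono)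
      fix i assume "i \<in> {..<n}"
      then have "i < n" by simp
      then have "?p (u i) \<le> ?p (v i)"
        using fam monoD[OF mono_positive_variation] by (simp add: interval_family_def)
      then show "\<bar>?p (v i) - ?p (u i)\<bar> \<le> (\<Sum>j<N i. g (V i j) - g (U i j)) + r"
        using approx[OF \<open>i < n\<close>] by simp
    qed
    also have "\<dots> = (\<Sum>k\<in>I. g (?V k) - g (?U k)) + real n * r"
      unfolding sum.distrib Sigma by (simp add: case_prod_beta)
    also have "\<dots> \<le> (\<Sum>k\<in>I. \<bar>g (?V k) - g (?U k)\<bar>) + real n * r"
      by (intro add_right_mono sum_mono) auto
    also have "real n * r \<le> e / 2"
      using \<open>0 < e\<close> by (simp add: r_def field_simps)
    finally show ?thesis
      using I_less by simp
  qed
  with d(1) show "\<exists>d>0. \<forall>(n::nat) u v. interval_family {..<n} u v \<longrightarrow> (\<Sum>i<n. v i - u i) < d \<longrightarrow>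
      (\<Sum>i<n. \<bar>?p (v i) - ?p (u i)\<bar>) < e"
    by blast
qed

end

text \<open>The subtracted part is the positive variation minus \<open>g\<close>, so its absolute
  continuity follows from that of the other two functions. Constancy to the left of \<open>c\<close>
  keeps the variation finite.\<close>

lemma abs_cont_decomposition:
  assumes ac: "abs_cont g" and const: "\<And>x. x \<le> c \<Longrightarrow> g x = g c"
  obtains p q where "mono p" "mono q" "abs_cont p" "abs_cont q" "\<And>x. g x = p x - q x"
proof
  have bdd: "bdd_above (variation_sums g x)" for x
  proof -
    obtain B where B: "\<forall>(n::nat) u v. interval_family {..<n} u v \<longrightarrow> (\<forall>i<n. v i \<le> x) \<longrightarrow>
        (\<Sum>i<n. g (v i) - g (u i)) \<le> B"
      by (rule abs_cont_bounded_sums[OF ac const])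
    show ?thesis
    proof (rule bdd_aboveI)
      fix s assume "s \<in> variation_sums g x"
      then show "s \<le> B"
        using B unfolding variation_sums_def by blast
    qed
  qed
  let ?p = "positive_variation g" and ?q = "\<lambda>x. positive_variation g x - g x"
  show "mono ?p"
    by (rule mono_positive_variation[OF bdd])
  show "mono ?q"
    using positive_variation_diff_ge[OF bdd] by (intro monoI) (simp add: algebra_simps)
  show "abs_cont ?p"
    by (rule abs_cont_positive_variation[OF bdd ac])
  then show "abs_cont ?q"
    using ac by (rule abs_cont_diff)
  show "g x = ?p x - ?q x" for x
    by simp
qed

section \<open>Lebesgue-Stieltjes measures and the fundamental theorem of calculus\<close>

text \<open>A null set sits in an open set of measure below \<open>d\<close>, and can be covered
  inside it by countably many nonoverlapping closed intervals. Any finitely many of these have total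
  length below \<open>d\<close>, so the increments of \<open>F\<close> over them, which are their
  measures since \<open>F\<close> is continuous, sum to less than \<open>e\<close>.\<close>

lemma interval_measure_absolutely_continuous:
  assumes "mono F" and ac: "abs_cont F"
  shows "absolutely_continuous lborel (interval_measure F)"
  unfolding absolutely_continuous_def
proof
  fix N :: "real set" assume "N \<in> null_sets lborel"
  then have N [measurable]: "N \<in> sets borel" and N0: "emeasure lborel N = 0"
    by auto
  let ?\<mu> = "interval_measure F"
  have F_mono: "x \<le> y \<Longrightarrow> F x \<le> F y" for x y
    using \<open>mono F\<close> by (rule monoD)
  have cont: "continuous_on UNIV F"
    by (rule abs_cont_imp_continuous[OF ac])
  have \<mu>_Icc: "emeasure ?\<mu> {x..y} = ennreal (F y - F x)" if "x \<le> y" for x y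
    using emeasure_interval_measure_Icc[OF that F_mono cont] .
  \<comment> \<open>The covering lemma works inside a bounded box with nonempty interior, hence the
    restriction to \<open>[-k, k]\<close> with positive \<open>k\<close>.\<close>
  have local: "emeasure ?\<mu> (N \<inter> {- real k..real k}) = 0" if "0 < k" for k :: nat
  proof -
    have small: "emeasure ?\<mu> (N \<inter> {- real k..real k}) \<le> 0 + ennreal e" if "0 < e" for e
    proof -
      \<comment> \<open>The covering intervals serve as their own indices, with \<open>Inf\<close>
        and \<open>Sup\<close> as endpoints.\<close>
      obtain d where d: "0 < d" "\<forall>(I :: real set set) u v. interval_family I u v \<longrightarrow>
          (\<Sum>i\<in>I. v i - u i) < d \<longrightarrow> (\<Sum>i\<in>I. \<bar>F (v i) - F (u i)\<bar>) < e"
        by (rule abs_contD[where 'i="real set", OF ac \<open>0 < e\<close>])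
      obtain U where U: "open U" "N \<subseteq> U" "emeasure lborel (U - N) < d"
        using outer_regular_lborel[OF N \<open>0 < d\<close>] by blast
      have "emeasure lborel U \<le> emeasure lborel (U - N) + emeasure lborel N"
        using U emeasure_subadditive[of "U - N" lborel N] by (simp add: Un_absorb2)
      then have U_small: "emeasure lborel U < d"
        using U(3) N0 by simp
      \<comment> \<open>Every covering interval lies in \<open>\<gamma> x\<close> for some
        \<open>x\<close> in \<open>N\<close>, and there the gauge equals \<open>U\<close>; this
        confines the whole cover to \<open>U\<close>.\<close>
      define \<gamma> where "\<gamma> x = (if x \<in> U then U else UNIV)" for x
      have "gauge \<gamma>"
        using \<open>open U\<close> by (auto simp: gauge_def \<gamma>_def)
      have box: "box (- real k) (real k) \<noteq> {}"
        using \<open>0 < k\<close> by simp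
      have Nk: "N \<inter> {- real k..real k} \<subseteq> cbox (- real k) (real k)"
        by simp
      obtain D where D: "countable D"
          "\<And>K. K \<in> D \<Longrightarrow> interior K \<noteq> {} \<and> (\<exists>c d. K = cbox c d)"
          "pairwise (\<lambda>A B. interior A \<inter> interior B = {}) D"
          "\<And>K. K \<in> D \<Longrightarrow> \<exists>x \<in> (N \<inter> {- real k..real k}) \<inter> K. K \<subseteq> \<gamma> x"
          "N \<inter> {- real k..real k} \<subseteq> \<Union>D"
        using covering_lemma[OF Nk box \<open>gauge \<gamma>\<close>] by metis
      have Icc: "K = {Inf K..Sup K}" "Inf K < Sup K" "K \<subseteq> U" if "K \<in> D" for K
      proof -
        from D(2)[OF that] obtain x y where K: "K = {x..y}" "x < y"
          by (auto simp: interior_atLeastAtMost_real)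
        then show "K = {Inf K..Sup K}" "Inf K < Sup K"
          by simp_all
        obtain z where "z \<in> N" "K \<subseteq> \<gamma> z"
          using D(4)[OF \<open>K \<in> D\<close>] by blast
        moreover have "\<gamma> z = U"
          using U(2) \<open>z \<in> N\<close> by (simp add: \<gamma>_def subset_iff)
        ultimately show "K \<subseteq> U"
          by simp
      qed
      have K_borel: "K \<in> sets borel" if "K \<in> D" for K
        using Icc(1)[OF that] by (metis borel_closed closed_atLeastAtMost)
      have "emeasure ?\<mu> (N \<inter> {- real k..real k}) \<le> emeasure ?\<mu> (\<Union>D)"
      proof (rule emeasure_mono[OF D(5)])
        have "\<Union>D \<in> sets borel"
          using D(1) K_borel by (intro sets.countable_Union) blast+
        then show "\<Union>D \<in> sets ?\<mu>"
          by simp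
      qed
      also have "\<dots> \<le> ennreal e"
      proof (rule emeasure_Union_countable_le[OF D(1)])
        show "D \<subseteq> sets ?\<mu>"
          using K_borel by auto
        fix G assume G: "finite G" "G \<subseteq> D"
        have fam: "interval_family G Inf Sup"
          unfolding interval_family_def disjoint_family_on_def
        proof (intro conjI ballI impI)
          show "finite G" by fact
          show "Inf K \<le> Sup K" if "K \<in> G" for K
            using Icc(2)[of K] that G(2) by auto
          fix K L assume "K \<in> G" "L \<in> G" "K \<noteq> L"
          then have KL: "K \<in> D" "L \<in> D" and "interior K \<inter> interior L = {}"
            using D(3) G(2) by (auto simp: pairwise_def)
          moreover have "interior K = {Inf K<..<Sup K}" "interior L = {Inf L<..<Sup L}"
            using Icc(1)[OF KL(1)] Icc(1)[OF KL(2)] interior_atLeastAtMost_real by metis+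
          ultimately show "{Inf K<..<Sup K} \<inter> {Inf L<..<Sup L} = {}"
            by simp
        qed
        have "ennreal (\<Sum>K\<in>G. Sup K - Inf K) \<le> emeasure lborel U"
        proof (rule sum_interval_family_le_emeasure[OF fam])
          fix K assume "K \<in> G"
          then have "K \<in> D"
            using G(2) by blast
          have "{Inf K<..<Sup K} \<subseteq> {Inf K..Sup K}"
            by auto
          then show "{Inf K<..<Sup K} \<subseteq> U"
            using Icc(1,3)[OF \<open>K \<in> D\<close>] by blast
        qed (use U(1) in simp)
        then have "ennreal (\<Sum>K\<in>G. Sup K - Inf K) < ennreal d"
          using U_small by (rule le_less_trans)
        then have "(\<Sum>K\<in>G. Sup K - Inf K) < d"
          using \<open>0 < d\<close> by (simp add: ennreal_less_iff sum_nonneg fam[unfolded interval_family_def])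
        then have F_sum: "(\<Sum>K\<in>G. \<bar>F (Sup K) - F (Inf K)\<bar>) < e"
          using d(2)[rule_format, OF fam] by simp
        have "emeasure ?\<mu> (\<Union>G) \<le> (\<Sum>K\<in>G. emeasure ?\<mu> K)"
          using emeasure_subadditive_finite[of G "\<lambda>K. K" ?\<mu>] G \<open>D \<subseteq> sets ?\<mu>\<close> by auto
        also have "\<dots> = (\<Sum>K\<in>G. ennreal \<bar>F (Sup K) - F (Inf K)\<bar>)"
        proof (rule sum.cong[OF refl])
          fix K assume "K \<in> G"
          then have K: "K \<in> D"
            using G(2) by blast
          have "emeasure ?\<mu> K = emeasure ?\<mu> {Inf K..Sup K}"
            using Icc(1)[OF K] by simp
          also have "\<dots> = ennreal \<bar>F (Sup K) - F (Inf K)\<bar>"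
            using \<mu>_Icc[of "Inf K" "Sup K"] F_mono[of "Inf K" "Sup K"] Icc(2)[OF K] by simp
          finally show "emeasure ?\<mu> K = ennreal \<bar>F (Sup K) - F (Inf K)\<bar>" .
        qed
        also have "\<dots> = ennreal (\<Sum>K\<in>G. \<bar>F (Sup K) - F (Inf K)\<bar>)"
          by (simp add: sum_ennreal)
        also have "\<dots> \<le> ennreal e"
          using F_sum by (intro ennreal_leI) simp
        finally show "emeasure ?\<mu> (\<Union>G) \<le> ennreal e" .
      qed
      finally show ?thesis
        by simp
    qed
    have "emeasure ?\<mu> (N \<inter> {- real k..real k}) \<le> 0"
      by (rule ennreal_le_epsilon) (rule small)
    then show ?thesis
      by simp
  qed
  have "N \<inter> {- real (Suc k)..real (Suc k)} \<in> null_sets ?\<mu>" for k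
    using local[of "Suc k"] by auto
  then have "(\<Union>k. N \<inter> {- real (Suc k)..real (Suc k)}) \<in> null_sets ?\<mu>"
    by (rule null_sets_UN)
  moreover have "(\<Union>k. N \<inter> {- real (Suc k)..real (Suc k)}) = N"
  proof -
    have "\<exists>k. x \<in> {- real (Suc k)..real (Suc k)}" for x
    proof -
      obtain k :: nat where "\<bar>x\<bar> < real k"
        using reals_Archimedean2 by blast
      then show ?thesis
        by (intro exI[of _ k]) auto
    qed
    then show ?thesis
      by blast
  qed
  ultimately show "N \<in> null_sets ?\<mu>"
    by simp
qed

lemma abs_cont_mono_density:
  assumes "mono F" "abs_cont F" "c \<le> d"
  obtains \<phi> where "integrable lborel \<phi>" "\<And>x. x \<in> {c..d} \<Longrightarrow> F x - F c = (LINT t:{..x}|lborel. \<phi> t)"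
    "\<And>t. t \<notin> {c<..d} \<Longrightarrow> \<phi> t = 0"
proof -
  let ?\<mu> = "interval_measure F"
  have F_mono: "x \<le> y \<Longrightarrow> F x \<le> F y" for x y
    using \<open>mono F\<close> by (rule monoD)
  have cont: "continuous (at_right x) F" for x
    using abs_cont_imp_continuous[OF assms(2)]
    by (meson continuous_on_eq_continuous_within continuous_within_subset subset_UNIV UNIV_I)
  have "\<exists>f\<in>borel_measurable lborel. density lborel f = ?\<mu>"
    by (rule sigma_finite_measure.Radon_Nikodym[OF sigma_finite_lborel interval_measure_absolutely_continuous[OF assms(1,2)]]) simp
  then obtain f :: "real \<Rightarrow> ennreal" where f: "f \<in> borel_measurable lborel" and "density lborel f = ?\<mu>"
    by blast
  then have f_Ioc: "(\<integral>\<^sup>+t. f t * indicator {x<..y} t \<partial>lborel) = ennreal (F y - F x)" if "x \<le> y" for x y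
    using emeasure_interval_measure_Ioc[OF that F_mono cont] emeasure_density[OF f, of "{x<..y}"]
    by simp
  have [measurable]: "f \<in> borel_measurable borel"
    using f by simp
  \<comment> \<open>The Radon-Nikodym density may be infinite, but on \<open>{c<..d}\<close> only on
    a null set, because its integral there is \<open>F d - F c\<close>; so \<open>enn2real\<close>
    loses nothing. The cutoff makes integrals over \<open>{..x}\<close> start at
    \<open>c\<close>.\<close>
  define \<phi> where "\<phi> t = enn2real (f t) * indicator {c<..d} t" for t
  have [measurable]: "\<phi> \<in> borel_measurable borel"
    unfolding \<phi>_def by measurable
  have "AE t in lborel. f t * indicator {c<..d} t \<noteq> \<infinity>"
    using f_Ioc[OF \<open>c \<le> d\<close>] by (intro nn_integral_noteq_infinite) auto
  then have AE_eq: "AE t in lborel. ennreal (indicator {..x} t * \<phi> t) = f t * indicator {c<..x} t" if "x \<in> {c..d}" for x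
  proof eventually_elim
    case (elim t)
    then show ?case
      using that by (auto simp: \<phi>_def indicator_def less_top[symmetric] split: if_splits)
  qed
  have nn: "(\<integral>\<^sup>+t. ennreal (indicator {..x} t * \<phi> t) \<partial>lborel) = ennreal (F x - F c)" if "x \<in> {c..d}" for x
    using nn_integral_cong_AE[OF AE_eq[OF that]] f_Ioc[of c x] that by simp
  show thesis
  proof
    have "integrable lborel (\<lambda>t. indicator {..d} t * \<phi> t)"
      using nn[of d] \<open>c \<le> d\<close> by (intro integrableI_nonneg) (auto simp: \<phi>_def)
    moreover have "indicator {..d} t * \<phi> t = \<phi> t" for t
      by (auto simp: \<phi>_def indicator_def)
    ultimately show "integrable lborel \<phi>"
      by simp
    show "F x - F c = (LINT t:{..x}|lborel. \<phi> t)" if "x \<in> {c..d}" for x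
      unfolding set_lebesgue_integral_def
      using nn[OF that] F_mono[of c x] that
      by (subst integral_eq_nn_integral) (auto simp: \<phi>_def)
    show "\<phi> t = 0" if "t \<notin> {c<..d}" for t
      using that by (simp add: \<phi>_def)
  qed
qed

text \<open>Subtracting the densities of the two monotone parts of the clamped function represents
  \<open>g\<close> on \<open>[c, d]\<close>. Near an interior point \<open>g\<close> is then a
  constant plus an indefinite integral, to which Lebesgue differentiation applies.\<close>

theorem absolutely_continuous_fundamental_theorem:
  assumes ac: "absolutely_continuous_on_interval c d g" and "c \<le> d"
  obtains \<phi> where "integrable lborel \<phi>"
    "\<forall>x\<in>{c..d}. g x - g c = (LINT t:{..x}|lborel. \<phi> t)"
    "\<forall>t. t \<notin> {c<..d} \<longrightarrow> \<phi> t = 0"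
    "AE t in lborel. t \<in> {c<..<d} \<longrightarrow> (g has_real_derivative \<phi> t) (at t)"
proof -
  let ?g = "\<lambda>x. g (max c (min d x))"
  have "?g x = ?g c" if "x \<le> c" for x
    using that \<open>c \<le> d\<close> by simp
  from abs_cont_decomposition[OF abs_cont_clamp[OF assms] this]
  obtain p q where pq: "mono p" "mono q" "abs_cont p" "abs_cont q" "\<forall>x. ?g x = p x - q x"
    by metis
  obtain \<phi>p where p: "integrable lborel \<phi>p" "\<forall>x\<in>{c..d}. p x - p c = (LINT t:{..x}|lborel. \<phi>p t)"
    "\<forall>t. t \<notin> {c<..d} \<longrightarrow> \<phi>p t = 0"
    using abs_cont_mono_density[OF pq(1,3) \<open>c \<le> d\<close>] by metis
  obtain \<phi>q where q: "integrable lborel \<phi>q" "\<forall>x\<in>{c..d}. q x - q c = (LINT t:{..x}|lborel. \<phi>q t)"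
    "\<forall>t. t \<notin> {c<..d} \<longrightarrow> \<phi>q t = 0"
    using abs_cont_mono_density[OF pq(2,4) \<open>c \<le> d\<close>] by metis
  let ?\<phi> = "\<lambda>t. \<phi>p t - \<phi>q t"
  have int: "integrable lborel ?\<phi>"
    using p(1) q(1) by simp
  have rep: "g x - g c = (LINT t:{..x}|lborel. ?\<phi> t)" if "x \<in> {c..d}" for x
  proof -
    have "(LINT t:{..x}|lborel. ?\<phi> t) = (p x - p c) - (q x - q c)"
      using p q that by (subst set_integral_diff) (auto intro!: set_integrable_lborel_subset)
    also have "\<dots> = ?g x - ?g c"
      using pq(5)[rule_format, of x] pq(5)[rule_format, of c] by simp
    finally show ?thesis
      using that by simp
  qed
  have zero: "?\<phi> t = 0" if "t \<notin> {c<..d}" for t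
    using p(3) q(3) that by simp
  have AE: "AE t in lborel. t \<in> {c<..<d} \<longrightarrow> (g has_real_derivative ?\<phi> t) (at t)"
    using lebesgue_differentiation_real[OF int]
  proof eventually_elim
    case (elim t)
    show ?case
    proof
      assume t: "t \<in> {c<..<d}"
      have "((\<lambda>y. g c + (LINT t:{..y}|lborel. ?\<phi> t)) has_real_derivative 0 + ?\<phi> t) (at t)"
        by (intro DERIV_add DERIV_const elim)
      then have "((\<lambda>y. g c + (LINT t:{..y}|lborel. ?\<phi> t)) has_real_derivative ?\<phi> t) (at t)"
        by simp
      then show "(g has_real_derivative ?\<phi> t) (at t)"
      proof (rule has_field_derivative_transform_within_open)
        show "g c + (LINT t:{..y}|lborel. ?\<phi> t) = g y" if "y \<in> {c<..<d}" for y
          using rep[of y] that by simp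
      qed (use t in auto)
    qed
  qed
  show thesis
    by (rule that[OF int _ _ AE]) (use rep zero in blast)+
qed

section \<open>The covariance inequality\<close>

text \<open>Enlarging \<open>{..x}\<close> by \<open>r\<close> gives \<open>{..<x + r}\<close>, and
  there are no atoms, so the quotient in \<open>boundary_measure\<close> is the difference quotient
  of the distribution function, which tends to \<open>f x\<close> at almost every
  \<open>x\<close>.\<close>

lemma AE_isoperimetric_const_le_density:
  assumes "prob_space M" and f [measurable]: "f \<in> borel_measurable borel" and nonneg: "\<And>x. 0 \<le> f x"
    and M: "M = density lborel (\<lambda>x. ennreal (f x))"
  shows "AE x in lborel. isoperimetric_const M * min (emeasure M {..x}) (1 - emeasure M {..x}) \<le> ennreal (f x)"
proof -
  interpret prob_space M by fact
  have [measurable_cong, simp]: "sets M = sets borel"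
    by (simp add: M)
  have "(\<integral>\<^sup>+x. ennreal (f x) \<partial>lborel) = emeasure M UNIV"
    by (simp add: M emeasure_density)
  also have "\<dots> = 1"
    using emeasure_space_1 by (simp add: M)
  finally have int: "integrable lborel f"
    using nonneg by (intro integrableI_nonneg) auto
  have em: "emeasure M {..x} = ennreal (LINT t:{..x}|lborel. f t)" for x
  proof -
    have "emeasure M {..x} = (\<integral>\<^sup>+t. ennreal (indicator {..x} t * f t) \<partial>lborel)"
      by (simp add: M emeasure_density) (intro nn_integral_cong, auto simp: indicator_def)
    also have "\<dots> = ennreal (\<integral>t. indicator {..x} t * f t \<partial>lborel)"
      using set_integrable_lborel_subset[OF int, of "{..x}"] nonneg
      by (intro nn_integral_eq_integral) (auto simp: set_integrable_def)
    finally show ?thesis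
      by (simp add: set_lebesgue_integral_def)
  qed
  let ?F = "\<lambda>x. LINT t:{..x}|lborel. f t"
  have F_mono: "?F x \<le> ?F y" if "x \<le> y" for x y
  proof -
    have "0 \<le> (LINT t:{x<..y}|lborel. f t)"
      using nonneg by (auto simp: set_lebesgue_integral_def intro!: integral_nonneg_AE)
    then show ?thesis
      using indefinite_integral_diff[OF int that] by simp
  qed
  have no_atom: "emeasure M {x} = 0" for x
    by (simp add: M emeasure_density)
  have open_half: "emeasure M {..<x} = emeasure M {..x}" for x
  proof -
    have "emeasure M ({..<x} \<union> {x}) = emeasure M {..<x}"
      using no_atom[of x] by (intro emeasure_Un_null_set) auto
    moreover have "{..<x} \<union> {x} = {..x}"
      by auto
    ultimately show ?thesis
      by simp
  qed
  have enl: "enlargement r {..x} = {..<x + r}" if "0 < r" for r x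
  proof (intro set_eqI iffI)
    fix y assume "y \<in> {..<x + r}"
    then show "y \<in> enlargement r {..x}"
      using that unfolding enlargement_def by (intro CollectI bexI[of _ "min x y"]) auto
  qed (auto simp: enlargement_def)
  show ?thesis
    using lebesgue_differentiation_real[OF int]
  proof eventually_elim
    case (elim x)
    let ?w = "min (emeasure M {..x}) (1 - emeasure M {..x})"
    have "((\<lambda>r. (?F (x + r) - ?F x) / r) \<longlongrightarrow> f x) (at 0)"
      using elim by (simp add: DERIV_def)
    then have "((\<lambda>r. (?F (x + r) - ?F x) / r) \<longlongrightarrow> f x) (at_right 0)"
      by (simp add: filterlim_at_split)
    then have "((\<lambda>r. ennreal ((?F (x + r) - ?F x) / r)) \<longlongrightarrow> ennreal (f x)) (at_right 0)"
      by (rule tendsto_ennrealI)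
    moreover have "\<forall>\<^sub>F r in at_right 0. ennreal ((?F (x + r) - ?F x) / r) =
        (emeasure M (enlargement r {..x}) - emeasure M {..x}) / ennreal r"
      using eventually_at_right_less[of "0 :: real"]
    proof eventually_elim
      case (elim r)
      have "0 \<le> ?F x"
        using nonneg by (auto simp: set_lebesgue_integral_def intro!: integral_nonneg_AE)
      then show ?case
        using elim F_mono[of x "x + r"]
        by (simp add: enl open_half em divide_ennreal ennreal_minus)
    qed
    ultimately have "((\<lambda>r. (emeasure M (enlargement r {..x}) - emeasure M {..x}) / ennreal r) \<longlongrightarrow> ennreal (f x)) (at_right 0)"
      by (rule Lim_transform_eventually)
    then have boundary: "boundary_measure M {..x} = ennreal (f x)"
      unfolding boundary_measure_def by (intro lim_imp_Liminf) simp_all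
    let ?C = "{c. \<forall>A\<in>sets M. c * min (emeasure M A) (1 - emeasure M A) \<le> boundary_measure M A}"
    \<comment> \<open>Multiplication commutes with suprema in \<open>ennreal\<close>, so the bound
      passes from each admissible \<open>c\<close> to the supremum, attained or not.\<close>
    have "isoperimetric_const M * ?w = (SUP c\<in>?C. c * ?w)"
      unfolding isoperimetric_const_def by (subst SUP_mult_right_ennreal[symmetric]) auto
    also have "\<dots> \<le> ennreal (f x)"
    proof (rule SUP_least)
      fix c assume "c \<in> ?C"
      then have "c * ?w \<le> boundary_measure M {..x}"
        by auto
      then show "c * ?w \<le> ennreal (f x)"
        by (simp add: boundary)
    qed
    finally show ?case .
  qed
qed

text \<open>If \<open>c\<close> is 0, the right-hand side is infinite because \<open>a\<close> is
  positive; \<open>c\<close> cannot be infinite, since with positive \<open>w\<close> the product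
  would exceed \<open>a\<close>.\<close>

lemma le_inverse_mult_ennreal:
  fixes c w :: ennreal
  assumes "c * w \<le> ennreal a" "0 < a" "0 < w"
  shows "w \<le> inverse c * ennreal a"
proof (cases "c = 0")
  case True
  then show ?thesis
    using \<open>0 < a\<close> by (simp add: ennreal_top_mult)
next
  case False
  have "c \<noteq> top"
    using assms by (auto simp: ennreal_top_mult top_unique split: if_splits)
  with False obtain r where r: "c = ennreal r" "0 < r"
    by (cases c) (auto simp: less_le)
  then have "inverse c * c = 1"
    by (simp add: inverse_ennreal ennreal_mult[symmetric])
  then have "w = inverse c * (c * w)"
    by (simp add: mult.assoc[symmetric])
  also have "\<dots> \<le> inverse c * ennreal a"
    by (rule mult_left_mono[OF assms(1)]) simp
  finally show ?thesis .
qed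

text \<open>Integrability may fail: the Bochner integral then has the default value 0.\<close>

lemma integral_norm_le_nn_integral:
  fixes f :: "'a \<Rightarrow> real"
  shows "ennreal \<bar>integral\<^sup>L M f\<bar> \<le> (\<integral>\<^sup>+x. ennreal \<bar>f x\<bar> \<partial>M)"
  using integral_norm_bound_ennreal[of M f]
  by (cases "integrable M f") (auto simp: not_integrable_integral_eq)

lemma integral_indefinite_integral_mult:
  fixes \<phi> H :: "real \<Rightarrow> real"
  assumes "sigma_finite_measure M" "sets M = sets borel"
    and \<phi>: "integrable lborel \<phi>" and H: "integrable M H"
  shows "(\<integral>x. (LINT t:{..x}|lborel. \<phi> t) * H x \<partial>M) = (\<integral>t. \<phi> t * (LINT x:{t..}|M. H x) \<partial>lborel)"
proof -
  interpret sigma_finite_measure M by fact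
  interpret pair_sigma_finite M lborel ..
  have [measurable_cong]: "sets M = sets borel" by fact
  have [measurable]: "\<phi> \<in> borel_measurable borel" "H \<in> borel_measurable M"
    using \<phi> H by auto
  have prod: "integrable (M \<Otimes>\<^sub>M lborel) (\<lambda>(x, t). H x * \<phi> t)"
  proof (rule Fubini_integrable)
    show "integrable M (\<lambda>x. \<integral>t. norm (case (x, t) of (x, t) \<Rightarrow> H x * \<phi> t) \<partial>lborel)"
      using H by (simp add: abs_mult)
    show "AE x in M. integrable lborel (\<lambda>t. case (x, t) of (x, t) \<Rightarrow> H x * \<phi> t)"
      using \<phi> by simp
  qed measurable
  \<comment> \<open>The integrand is the product restricted to the region \<open>t \<le> x\<close>,
    hence dominated by the product.\<close>
  have cut: "integrable (M \<Otimes>\<^sub>M lborel) (\<lambda>(x, t). if t \<le> x then H x * \<phi> t else 0)"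
    by (rule Bochner_Integration.integrable_bound[OF prod]) auto
  have "(\<integral>x. (LINT t:{..x}|lborel. \<phi> t) * H x \<partial>M) = (\<integral>x. (\<integral>t. (if t \<le> x then H x * \<phi> t else 0) \<partial>lborel) \<partial>M)"
  proof (rule Bochner_Integration.integral_cong[OF refl])
    fix x
    have "(LINT t:{..x}|lborel. \<phi> t) * H x = (\<integral>t. indicator {..x} t *\<^sub>R \<phi> t * H x \<partial>lborel)"
      by (simp add: set_lebesgue_integral_def)
    also have "\<dots> = (\<integral>t. (if t \<le> x then H x * \<phi> t else 0) \<partial>lborel)"
      by (intro Bochner_Integration.integral_cong) auto
    finally show "(LINT t:{..x}|lborel. \<phi> t) * H x = (\<integral>t. (if t \<le> x then H x * \<phi> t else 0) \<partial>lborel)" .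
  qed
  also have "\<dots> = (\<integral>t. (\<integral>x. (if t \<le> x then H x * \<phi> t else 0) \<partial>M) \<partial>lborel)"
    by (rule Fubini_integral[OF cut, symmetric])
  also have "\<dots> = (\<integral>t. \<phi> t * (LINT x:{t..}|M. H x) \<partial>lborel)"
  proof (rule Bochner_Integration.integral_cong[OF refl])
    fix t
    have "(\<integral>x. (if t \<le> x then H x * \<phi> t else 0) \<partial>M) = (\<integral>x. \<phi> t * (indicator {t..} x *\<^sub>R H x) \<partial>M)"
      by (intro Bochner_Integration.integral_cong) auto
    then show "(\<integral>x. (if t \<le> x then H x * \<phi> t else 0) \<partial>M) = \<phi> t * (LINT x:{t..}|M. H x)"
      by (simp add: set_lebesgue_integral_def)
  qed
  finally show ?thesis .
qed

text \<open>A closed set of full Lebesgue measure is the whole line. The bound must hold at every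
  point because truncating \<open>g\<close> spreads its values at single points over whole
  half-lines.\<close>

lemma continuous_abs_le_if_AE_lborel:
  fixes g :: "real \<Rightarrow> real"
  assumes cont: "continuous_on UNIV g" and AE: "AE x in lborel. \<bar>g x\<bar> \<le> C"
  shows "\<bar>g x\<bar> \<le> C"
proof -
  have "closed {x. \<bar>g x\<bar> \<le> C}"
    using cont by (intro closed_Collect_le continuous_intros) auto
  moreover have "AE x in lebesgue. x \<in> {x. \<bar>g x\<bar> \<le> C}"
    using AE_completion[OF AE] by simp
  ultimately have "x \<in> {x. \<bar>g x\<bar> \<le> C}"
    by (rule mem_closed_if_AE_lebesgue)
  then show ?thesis
    by simp
qed

lemma locally_absolutely_continuous_imp_continuous:
  assumes "locally_absolutely_continuous g"
  shows "continuous_on UNIV g"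
proof -
  have "continuous (at x) g" for x
  proof -
    have "abs_cont (\<lambda>y. g (max (x - 1) (min (x + 1) y)))"
      using assms by (intro abs_cont_clamp) (auto simp: locally_absolutely_continuous_def)
    then have "continuous_on {x - 1<..<x + 1} (\<lambda>y. g (max (x - 1) (min (x + 1) y)))"
      using abs_cont_imp_continuous continuous_on_subset by blast
    then have "continuous_on {x - 1<..<x + 1} g"
      by (rule continuous_on_eq) auto
    then show ?thesis
      by (simp add: continuous_on_eq_continuous_at)
  qed
  then show ?thesis
    by (simp add: continuous_at_imp_continuous_on)
qed

lemma emeasure_density_pos:
  assumes f: "f \<in> borel_measurable borel" and pos: "\<And>x. 0 < f x"
    and M: "M = density lborel (\<lambda>x. ennreal (f x))"
    and A: "A \<in> sets borel" "emeasure lborel A \<noteq> 0"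
  shows "0 < emeasure M A"
proof (rule ccontr)
  assume "\<not> 0 < emeasure M A"
  then have "A \<in> null_sets M"
    using A(1) by (auto simp: M)
  then have "AE x in lborel. x \<in> A \<longrightarrow> ennreal (f x) = 0"
    using f by (simp add: M null_sets_density_iff)
  then have "AE x in lborel. x \<notin> A"
    using pos by (auto elim!: eventually_mono simp: ennreal_eq_0_iff not_le[symmetric])
  then show False
    using A by (simp add: AE_iff_null_sets[symmetric] null_sets_def)
qed

text \<open>Intervals of positive length have positive mass. This keeps both denominators positive
  and makes the endpoints of the support infinite.\<close>

lemma cdf_density_strict_bounds:
  assumes "prob_space M" and f: "f \<in> borel_measurable borel" and pos: "\<And>x. 0 < f x"
    and M: "M = density lborel (\<lambda>x. ennreal (f x))"
  shows "0 < cdf M x" "cdf M x < 1"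
proof -
  interpret prob_space M by fact
  have M_pos: "0 < measure M A" if "A \<in> sets borel" "emeasure lborel A \<noteq> 0" for A
    using emeasure_density_pos[OF f pos M that] by (simp add: emeasure_eq_measure)
  have "0 < measure M {x - 1..x}"
    by (rule M_pos) auto
  also have "\<dots> \<le> cdf M x"
    unfolding cdf_def by (intro finite_measure_mono) (auto simp: M)
  finally show "0 < cdf M x" .
  have "cdf M x < cdf M x + measure M {x<..x + 1}"
    using M_pos[of "{x<..x + 1}"] by simp
  also have "\<dots> = measure M ({..x} \<union> {x<..x + 1})"
    unfolding cdf_def by (intro finite_measure_Union[symmetric]) (auto simp: M)
  also have "\<dots> \<le> 1"
    by (rule prob_le_1)
  finally show "cdf M x < 1" .
qed

lemma covariance_le_of_density_pos:
  fixes M :: "real measure" and f g h :: "real \<Rightarrow> real" and m :: real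
  assumes M_prob: "prob_space M"
    and f [measurable]: "f \<in> borel_measurable borel"
    and f_pos: "\<And>x. 0 < f x"
    and M: "M = density lborel (\<lambda>x. ennreal (f x))"
    and median: "is_median M m"
    and g_meas: "g \<in> borel_measurable M"
    and g_bdd: "esssup M (\<lambda>x. ereal \<bar>g x\<bar>) < \<infinity>"
    and h: "integrable M h"
    and g_ac: "locally_absolutely_continuous g"
  shows "ennreal \<bar>covariance M g h\<bar> \<le>
    inverse (isoperimetric_const M) *
    max (SUP x\<in>{..m}.
           ennreal \<bar>(LINT y:{..<x}|M. h y) / cdf M x - (LINT y|M. h y)\<bar>)
        (SUP x\<in>{m<..}.
           ennreal \<bar>(LINT y:{x<..}|M. h y) / (1 - cdf M x) - (LINT y|M. h y)\<bar>) *
    (\<integral>\<^sup>+x. ennreal \<bar>deriv g x\<bar> \<partial>M)"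
    (is "_ \<le> ?I * max ?S1 ?S2 * ?N")
proof -
  interpret prob_space M by fact
  have sets_M [measurable_cong, simp]: "sets M = sets borel"
    by (simp add: M)
  have space_M [simp]: "space M = UNIV"
    by (simp add: M)
  have AE_M: "AE x in M. P x" if "AE x in lborel. P x" for P
    using that unfolding M by (subst AE_density) auto
  have no_atom: "{x} \<in> null_sets M" for x
    by (auto simp: null_sets_def M emeasure_density)
  have half_line: "measure M {..<x} = cdf M x" "measure M {x..} = 1 - cdf M x" "measure M {x<..} = 1 - cdf M x" for x
  proof -
    have "measure M ({..<x} \<union> {x}) = measure M {..<x}"
      using no_atom[of x] by (intro measure_Un_null_set) auto
    moreover have "{..<x} \<union> {x} = {..x}"
      by auto
    ultimately show 1: "measure M {..<x} = cdf M x"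
      by (simp add: cdf_def)
    have "{x..} = UNIV - {..<x}" "{x<..} = UNIV - {..x}"
      by auto
    then show "measure M {x..} = 1 - cdf M x" "measure M {x<..} = 1 - cdf M x"
      using prob_compl[of "{..<x}"] prob_compl[of "{..x}"] 1 by (simp_all add: cdf_def)
  qed
  have cdf_pos: "0 < cdf M x" and cdf_less: "cdf M x < 1" for x
    using cdf_density_strict_bounds[OF M_prob f f_pos M] by auto
  have cdf_mono: "cdf M x \<le> cdf M y" if "x \<le> y" for x y
    using that unfolding cdf_def by (intro finite_measure_mono) auto
  \<comment> \<open>Without atoms the two median conditions become \<open>F m \<ge> 1 / 2\<close>
    and \<open>1 - F m \<ge> 1 / 2\<close>. Monotonicity then identifies \<open>W\<close> with
    \<open>F\<close> up to \<open>m\<close> and with \<open>1 - F\<close> beyond.\<close>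
  have cdf_m: "cdf M m = 1 / 2"
    using median half_line(2)[of m] by (simp add: is_median_def cdf_def)
  define W where "W t = min (cdf M t) (1 - cdf M t)" for t
  have W_pos: "0 < W t" for t
    using cdf_pos[of t] cdf_less[of t] by (simp add: W_def)
  have W_eq: "min (emeasure M {..t}) (1 - emeasure M {..t}) = ennreal (W t)" for t
    using cdf_pos[of t] cdf_less[of t]
    by (simp add: W_def cdf_def emeasure_eq_measure ennreal_minus ennreal_1[symmetric] min_def del: ennreal_1)
  have W_le: "AE t in lborel. ennreal (W t) \<le> ?I * ennreal (f t)"
    using AE_isoperimetric_const_le_density[OF M_prob f less_imp_le[OF f_pos] M]
  proof eventually_elim
    case (elim t)
    then show ?case
      using W_pos f_pos by (intro le_inverse_mult_ennreal) (auto simp: W_eq)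
  qed
  define E where "E = (LINT y|M. h y)"
  define H where "H x = h x - E" for x
  have H: "integrable M H"
    unfolding H_def using h by simp
  have H_zero: "(LINT x|M. H x) = 0"
    unfolding H_def using h prob_space by (simp add: E_def)
  have H_sub: "set_integrable M A H" "set_integrable M A h" if "A \<in> sets borel" for A
    unfolding set_integrable_def by (rule integrable_mult_indicator; use that H h in simp)+
  have H_set: "(LINT x:A|M. H x) = (LINT x:A|M. h x) - E * measure M A" if "A \<in> sets borel" for A
  proof -
    have "(LINT x:A|M. H x) = (LINT x:A|M. h x) - (LINT x:A|M. E)"
      unfolding H_def using that H_sub(2)
      by (intro set_integral_diff) (auto simp: set_integrable_def emeasure_eq_measure)
    then show ?thesis
      using that by (simp add: set_lebesgue_integral_def emeasure_eq_measure)
  qed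
  define \<Psi> where "\<Psi> t = (LINT x:{t..}|M. H x)" for t
  have \<Psi>_left: "\<bar>\<Psi> t\<bar> = cdf M t * \<bar>(LINT y:{..<t}|M. h y) / cdf M t - E\<bar>" for t
  proof -
    have "(LINT x:{..<t} \<union> {t..}|M. H x) = (LINT x:{..<t}|M. H x) + \<Psi> t"
      unfolding \<Psi>_def by (intro set_integral_Un H_sub) auto
    moreover have "{..<t} \<union> {t..} = UNIV"
      by auto
    ultimately have "\<Psi> t = - ((LINT x:{..<t}|M. h x) - E * cdf M t)"
      using H_zero H_set[of "{..<t}"] by (simp add: set_lebesgue_integral_def[of M UNIV] half_line)
    also have "\<dots> = - (cdf M t * ((LINT y:{..<t}|M. h y) / cdf M t - E))"
      using cdf_pos[of t] by (simp add: field_simps)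
    finally show ?thesis
      using cdf_pos[of t] by (simp add: abs_mult)
  qed
  \<comment> \<open>The closed half-line of \<open>\<Psi>\<close> and the open one of the supremum
    differ by a null point.\<close>
  have \<Psi>_right: "\<bar>\<Psi> t\<bar> = (1 - cdf M t) * \<bar>(LINT y:{t<..}|M. h y) / (1 - cdf M t) - E\<bar>" for t
  proof -
    have "AE x in M. x \<noteq> t"
      using no_atom[of t] by (auto dest: AE_not_in)
    then have "\<Psi> t = (LINT x:{t<..}|M. H x)"
      unfolding \<Psi>_def set_lebesgue_integral_def using H
      by (intro integral_cong_AE) (auto elim!: eventually_mono simp: indicator_def)
    also have "\<dots> = (LINT x:{t<..}|M. h x) - E * (1 - cdf M t)"
      by (subst H_set) (auto simp: half_line)
    also have "\<dots> = (1 - cdf M t) * ((LINT y:{t<..}|M. h y) / (1 - cdf M t) - E)"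
      using cdf_less[of t] by (simp add: field_simps)
    finally show ?thesis
      using cdf_less[of t] by (simp add: abs_mult)
  qed
  have \<Psi>_le: "ennreal \<bar>\<Psi> t\<bar> \<le> max ?S1 ?S2 * ennreal (W t)" for t
  proof (cases "t \<le> m")
    case True
    then have "W t = cdf M t"
      using cdf_mono[of t m] cdf_m by (simp add: W_def)
    then have "ennreal \<bar>\<Psi> t\<bar> = ennreal \<bar>(LINT y:{..<t}|M. h y) / cdf M t - E\<bar> * ennreal (W t)"
      using cdf_pos[of t] by (simp add: \<Psi>_left ennreal_mult[symmetric] mult.commute)
    also have "\<dots> \<le> max ?S1 ?S2 * ennreal (W t)"
      using True unfolding E_def by (intro mult_right_mono max.coboundedI1 SUP_upper) auto
    finally show ?thesis .
  next
    case False
    then have "W t = 1 - cdf M t"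
      using cdf_mono[of m t] cdf_m by (simp add: W_def)
    then have "ennreal \<bar>\<Psi> t\<bar> = ennreal \<bar>(LINT y:{t<..}|M. h y) / (1 - cdf M t) - E\<bar> * ennreal (W t)"
      using cdf_less[of t] by (simp add: \<Psi>_right ennreal_mult[symmetric] mult.commute)
    also have "\<dots> \<le> max ?S1 ?S2 * ennreal (W t)"
      using False unfolding E_def by (intro mult_right_mono max.coboundedI2 SUP_upper) auto
    finally show ?thesis .
  qed
  define G where "G n x = g (max (- real n) (min (real n) x))" for n :: nat and x
  have truncated: "ennreal \<bar>LINT x|M. G n x * H x\<bar> \<le> ?I * max ?S1 ?S2 * ?N" for n
  proof -
    have n: "- real n \<le> real n" by simp
    have "absolutely_continuous_on_interval (- real n) (real n) g"
      using g_ac by (simp add: locally_absolutely_continuous_def)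
    then obtain \<phi> where \<phi>: "integrable lborel \<phi>"
      and rep: "\<forall>x\<in>{- real n..real n}. g x - g (- real n) = (LINT t:{..x}|lborel. \<phi> t)"
      and outside: "\<forall>t. t \<notin> {- real n<..real n} \<longrightarrow> \<phi> t = 0"
      and deriv: "AE t in lborel. t \<in> {- real n<..<real n} \<longrightarrow> (g has_real_derivative \<phi> t) (at t)"
      by (rule absolutely_continuous_fundamental_theorem[OF _ n])
    have [measurable]: "\<phi> \<in> borel_measurable borel"
      using \<phi> by auto
    \<comment> \<open>Valid for every \<open>x\<close>, not only on \<open>[-n, n]\<close>, because
      \<open>\<phi>\<close> vanishes outside, just as the truncated function is constant
      there.\<close>
    have G_rep: "G n x = g (- real n) + (LINT t:{..x}|lborel. \<phi> t)" for x
    proof -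
      have "(LINT t:{..x}|lborel. \<phi> t) = (LINT t:{..max (- real n) (min (real n) x)}|lborel. \<phi> t)"
        unfolding set_lebesgue_integral_def
      proof (rule Bochner_Integration.integral_cong[OF refl])
        fix t
        show "indicator {..x} t *\<^sub>R \<phi> t = indicator {..max (- real n) (min (real n) x)} t *\<^sub>R \<phi> t"
          using outside[rule_format, of t] by (cases "t \<in> {- real n<..real n}") (auto simp: indicator_def)
      qed
      then show ?thesis
        using rep[THEN bspec, of "max (- real n) (min (real n) x)"] by (simp add: G_def)
    qed
    have bound_G: "\<bar>LINT t:{..x}|lborel. \<phi> t\<bar> \<le> (LINT t|lborel. \<bar>\<phi> t\<bar>)" for x
      unfolding set_lebesgue_integral_def
      by (rule order_trans[OF integral_abs_bound] integral_mono)+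
        (use \<phi> set_integrable_lborel_subset[OF \<phi>, of "{..x}"] in \<open>auto simp: set_integrable_def indicator_def\<close>)
    have "(\<lambda>x. LINT t:{..x}|lborel. \<phi> t) \<in> borel_measurable borel"
    proof -
      have "(\<lambda>x. \<integral>t. (if t \<le> x then \<phi> t else 0) \<partial>lborel) \<in> borel_measurable borel"
        by measurable
      moreover have "(LINT t:{..x}|lborel. \<phi> t) = (\<integral>t. (if t \<le> x then \<phi> t else 0) \<partial>lborel)" for x
        unfolding set_lebesgue_integral_def by (intro Bochner_Integration.integral_cong) auto
      ultimately show ?thesis
        by simp
    qed
    then have [measurable]: "(\<lambda>x. LINT t:{..x}|lborel. \<phi> t) \<in> borel_measurable M"
      by simp
    have int: "integrable M (\<lambda>x. (LINT t:{..x}|lborel. \<phi> t) * H x)"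
    proof (rule Bochner_Integration.integrable_bound)
      show "integrable M (\<lambda>x. (LINT t|lborel. \<bar>\<phi> t\<bar>) * H x)"
        using H by simp
      show "AE x in M. norm ((LINT t:{..x}|lborel. \<phi> t) * H x) \<le> norm ((LINT t|lborel. \<bar>\<phi> t\<bar>) * H x)"
        using bound_G by (intro AE_I2) (auto simp: abs_mult intro!: mult_right_mono order_trans[OF bound_G])
    qed (use H in measurable)
    have "(LINT x|M. G n x * H x) = (LINT x|M. g (- real n) * H x + (LINT t:{..x}|lborel. \<phi> t) * H x)"
      by (simp add: G_rep distrib_right)
    \<comment> \<open>The constant \<open>g (- real n)\<close> drops out since \<open>H\<close> has
      mean zero.\<close>
    also have "\<dots> = (LINT x|M. (LINT t:{..x}|lborel. \<phi> t) * H x)"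
      using int H H_zero by simp
    also have "\<dots> = (\<integral>t. \<phi> t * \<Psi> t \<partial>lborel)"
      unfolding \<Psi>_def by (rule integral_indefinite_integral_mult[OF _ sets_M \<phi> H]) unfold_locales
    finally have "ennreal \<bar>LINT x|M. G n x * H x\<bar> \<le> (\<integral>\<^sup>+t. ennreal \<bar>\<phi> t * \<Psi> t\<bar> \<partial>lborel)"
      by (simp only: integral_norm_le_nn_integral)
    also have "\<dots> \<le> (\<integral>\<^sup>+t. ?I * max ?S1 ?S2 * (ennreal (f t) * ennreal \<bar>\<phi> t\<bar>) \<partial>lborel)"
    proof (rule nn_integral_mono_AE)
      show "AE t in lborel. ennreal \<bar>\<phi> t * \<Psi> t\<bar> \<le> ?I * max ?S1 ?S2 * (ennreal (f t) * ennreal \<bar>\<phi> t\<bar>)"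
        using W_le
      proof eventually_elim
        case (elim t)
        have "ennreal \<bar>\<phi> t * \<Psi> t\<bar> = ennreal \<bar>\<phi> t\<bar> * ennreal \<bar>\<Psi> t\<bar>"
          by (simp add: abs_mult ennreal_mult)
        \<comment> \<open>Chaining \<open>\<bar>\<Psi>\<bar> \<le> S * W \<le> S * (I * f)\<close>,
          where \<open>S\<close> is the maximum and \<open>I\<close> the inverse constant, remains
          valid when \<open>S\<close> is 0 and \<open>I\<close> infinite.\<close>
        also have "\<dots> \<le> ennreal \<bar>\<phi> t\<bar> * (max ?S1 ?S2 * (?I * ennreal (f t)))"
          using order_trans[OF \<Psi>_le mult_left_mono[OF elim]] by (intro mult_left_mono) auto
        also have "\<dots> = ?I * max ?S1 ?S2 * (ennreal (f t) * ennreal \<bar>\<phi> t\<bar>)"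
          by (simp only: ac_simps)
        finally show ?case .
      qed
    qed
    also have "\<dots> = ?I * max ?S1 ?S2 * (\<integral>\<^sup>+t. ennreal (f t) * ennreal \<bar>\<phi> t\<bar> \<partial>lborel)"
      by (rule nn_integral_cmult) measurable
    also have "(\<integral>\<^sup>+t. ennreal (f t) * ennreal \<bar>\<phi> t\<bar> \<partial>lborel) = (\<integral>\<^sup>+t. ennreal \<bar>\<phi> t\<bar> \<partial>M)"
      unfolding M by (rule nn_integral_density[symmetric]) measurable
    \<comment> \<open>Inside the open interval \<open>\<phi>\<close> is almost everywhere
      \<open>deriv g\<close>, outside it is 0; only the right endpoint \<open>n\<close> is covered
      by neither fact, and it is null.\<close>
    also have "\<dots> \<le> ?N"
    proof (rule nn_integral_mono_AE, rule AE_M)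
      have "AE t in lborel. t \<noteq> real n"
        by (rule AE_lborel_singleton)
      with deriv show "AE t in lborel. ennreal \<bar>\<phi> t\<bar> \<le> ennreal \<bar>deriv g t\<bar>"
      proof eventually_elim
        case (elim t)
        show ?case
        proof (cases "t \<in> {- real n<..<real n}")
          case True
          then show ?thesis
            using elim by (simp add: DERIV_imp_deriv)
        next
          case False
          then show ?thesis
            using outside[rule_format, of t] elim by auto
        qed
      qed
    qed
    finally show ?thesis
      by (simp add: mult_left_mono)
  qed
  have g_cont: "continuous_on UNIV g"
    by (rule locally_absolutely_continuous_imp_continuous[OF g_ac])
  obtain C where C: "\<bar>g x\<bar> \<le> C" for x
  proof -
    obtain C where "esssup M (\<lambda>x. ereal \<bar>g x\<bar>) \<le> ereal C"
      using g_bdd by (cases "esssup M (\<lambda>x. ereal \<bar>g x\<bar>)") auto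
    then have "AE x in M. \<bar>g x\<bar> \<le> C"
      using esssup_AE[of "\<lambda>x. ereal \<bar>g x\<bar>" M]
      by (auto elim!: eventually_mono dest: order_trans)
    \<comment> \<open>Positivity of the density makes null sets of \<open>M\<close> Lebesgue
      null.\<close>
    then have "AE x in lborel. \<bar>g x\<bar> \<le> C"
      using f_pos unfolding M by (subst (asm) AE_density) auto
    then show thesis
      using continuous_abs_le_if_AE_lborel[OF g_cont] that by blast
  qed
  \<comment> \<open>At each \<open>x\<close> the sequence is eventually constant. The truncations
    only take values of \<open>g\<close>, so the bound \<open>C\<close> gives an integrable
    majorant.\<close>
  have "(\<lambda>n. LINT x|M. G n x * H x) \<longlonglongrightarrow> (LINT x|M. g x * H x)"
  proof (rule integral_dominated_convergence[where w = "\<lambda>x. C * \<bar>H x\<bar>"])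
    have [measurable]: "g \<in> borel_measurable borel" "H \<in> borel_measurable M"
      using g_meas H by auto
    show "(\<lambda>x. g x * H x) \<in> borel_measurable M"
      by measurable
    show "(\<lambda>x. G n x * H x) \<in> borel_measurable M" for n
      unfolding G_def by measurable
    show "integrable M (\<lambda>x. C * \<bar>H x\<bar>)"
      using H by simp
    show "AE x in M. norm (G n x * H x) \<le> C * \<bar>H x\<bar>" for n
      using C by (intro AE_I2) (auto simp: abs_mult G_def intro!: mult_right_mono)
    show "AE x in M. (\<lambda>n. G n x * H x) \<longlonglongrightarrow> g x * H x"
    proof (intro AE_I2 tendsto_eventually)
      fix x
      obtain k :: nat where "\<bar>x\<bar> < real k"
        using reals_Archimedean2 by blast
      then have "G n x * H x = g x * H x" if "n \<ge> k" for n
        using that by (simp add: G_def)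
      then show "\<forall>\<^sub>F n in sequentially. G n x * H x = g x * H x"
        by (auto simp: eventually_sequentially)
    qed
  qed
  moreover have "(LINT x|M. g x * H x) = covariance M g h"
    by (simp add: covariance_def H_def E_def)
  ultimately have "(\<lambda>n. ennreal \<bar>LINT x|M. G n x * H x\<bar>) \<longlonglongrightarrow> ennreal \<bar>covariance M g h\<bar>"
    by (intro tendsto_ennrealI tendsto_rabs) simp
  then show ?thesis
    by (rule LIMSEQ_le_const2) (use truncated in auto)
qed

theorem theorem2p1:
  fixes M :: "real measure" and f g h :: "real \<Rightarrow> real" and m :: real and a b :: ereal
  assumes "prob_space M"
    and "f \<in> borel_measurable borel"
    and "\<And>x. 0 < f x"
    and "M = density lborel (\<lambda>x. ennreal (f x))"
    and "is_median M m"
    and "g \<in> borel_measurable M"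
    and "esssup M (\<lambda>x. ereal \<bar>g x\<bar>) < \<infinity>"
    and "integrable M h"
    and "locally_absolutely_continuous g"
    and "locally_absolutely_continuous h"
    and "a = lower_endpoint M"
    and "b = upper_endpoint M"
  shows "ennreal \<bar>covariance M g h\<bar> \<le>
    inverse (isoperimetric_const M) *
    max (SUP x\<in>{x. a < ereal x \<and> x \<le> m}.
           ennreal \<bar>(LINT y=a..ereal x|M. h y) / cdf M x - (LINT y|M. h y)\<bar>)
        (SUP x\<in>{x. m < x \<and> ereal x < b}.
           ennreal \<bar>(LINT y=ereal x..b|M. h y) / (1 - cdf M x) - (LINT y|M. h y)\<bar>) *
    (\<integral>\<^sup>+x. ennreal \<bar>deriv g x\<bar> \<partial>M)"
proof -
  note bounds = cdf_density_strict_bounds[OF assms(1-4)]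
  have a: "a = - \<infinity>"
    unfolding assms(11) lower_endpoint_def by (intro ereal_bot Inf_lower) (use bounds in auto)
  have b: "b = \<infinity>"
    unfolding assms(12) upper_endpoint_def by (intro ereal_top Sup_upper) (use bounds in auto)
  have "{x. a < ereal x \<and> x \<le> m} = {..m}" "{x. m < x \<and> ereal x < b} = {m<..}"
    by (auto simp: a b)
  \<comment> \<open>Interval integrals are taken over open intervals, hence the strict
    half-lines.\<close>
  moreover have "(LINT y=a..ereal x|M. h y) = (LINT y:{..<x}|M. h y)"
    "(LINT y=ereal x..b|M. h y) = (LINT y:{x<..}|M. h y)" for x
    by (simp_all add: a b interval_lebesgue_integral_def)
  ultimately show ?thesis
    using covariance_le_of_density_pos[OF assms(1-9)] by simp
qed

end
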